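(* Let $G\leq\operatorname{Aut}(T)$ be a branch group, let $F\leq G$ be any subgroup and let $v$ be a vertex of $T$. (1) If all orbit-closures of the action $\operatorname{Stab}_F(v)\curvearrowright\partial T$ are non-open, then $F$ is contained in uncountably many generalized parabolic subgroups of $G$. (2) If all orbits of the action $\operatorname{Stab}_F(v)\curvearrowright\partial T$ are at most countable and closed, then $F$ is contained in a continuum of generalized parabolic subgroups of $G$. If moreover $\operatorname{Stab}_F(v)$ is non-trivial, then $F$ is contained in a continuum of generalized parabolic subgroups of $G$ that are not parabolic.
   Context: $T$ is a rooted tree; all rooted trees are infinite and spherically regular (the number of children of a vertex depends only on its level), and every vertex has at least two children. $\operatorname{Aut}(T)$ is the group of graph automorphisms fixing the root; $\mathcal L_n$ is the set of vertices of level $n$; $T_v$ is the subtree of descendants of $v$. The boundary $\partial T$ is the set of infinite rays starting at the root, with the metric in which two distinct rays first differing at index $i$ are at distance $2^{-i}$. For $G\le\operatorname{Aut}(T)$, $\operatorname{Rist}_G(v)$ is the subgroup of elements acting trivially outside $T_v$, and $\operatorname{Rist}_G(\mathcal L_n)=\prod_{v\in\mathcal L_n}\operatorname{Rist}_G(v)$. $G$ is branch if it acts transitively on every $\mathcal L_n$ and $\operatorname{Rist}_G(\mathcal L_n)$ has finite index in $G$ for every $n$. $\operatorname{Stab}_F(v)$ is the stabilizer of $v$ in $F$. An orbit-closure is the closure in $\partial T$ of an orbit. $\operatorname{SStab}_G(C)$ is the setwise stabilizer of $C\subseteq \partial T$. A generalized parabolic subgroup of $G$ is a subgroup of the form $\operatorname{SStab}_G(C)$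 where $C\subset\partial T$ is closed and not open and the action $\operatorname{SStab}_G(C)\curvearrowright C$ is minimal (every orbit is dense in $C$). A parabolic subgroup of $G$ is the stabilizer $\operatorname{Stab}_G(\xi)$ of a ray $\xi\in\partial T$. "A continuum of subgroups" means $2^{\aleph_0}$ pairwise distinct subgroups. *)

theory Defs
  imports
    "HOL-Analysis.Abstract_Metric_Spaces"
    "HOL-Library.Equipollence"
    "HOL-Library.Countable_Set"
    "HOL-Algebra.Bij"
    "HOL-Algebra.Generated_Groups"
begin

section \<open>Rooted trees\<close>

text \<open>
  The vertex set of a tree is the whole type \<open>'v\<close>.  A rooted tree is given by its root and the
  relation \<open>is_child T u w\<close>, read as \<open>w\<close> is a child of \<open>u\<close>, i.e. its edges oriented away from
  the root.
\<close>

record 'v rooted_tree =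
  tree_root :: 'v
  is_child :: "'v \<Rightarrow> 'v \<Rightarrow> bool"

definition rooted_tree :: "'v rooted_tree \<Rightarrow> bool" where
  "rooted_tree T \<longleftrightarrow>
     (\<forall>u. \<not> is_child T u (tree_root T)) \<and>
     (\<forall>u u' w. is_child T u w \<and> is_child T u' w \<longrightarrow> u = u') \<and>
     (\<forall>v. (is_child T)\<^sup>*\<^sup>* (tree_root T) v)"

definition adjacent :: "'v rooted_tree \<Rightarrow> 'v \<Rightarrow> 'v \<Rightarrow> bool" where
  "adjacent T u w \<longleftrightarrow> is_child T u w \<or> is_child T w u"

definition level :: "'v rooted_tree \<Rightarrow> nat \<Rightarrow> 'v set" where
  "level T n = {v. (is_child T ^^ n) (tree_root T) v}"

definition children :: "'v rooted_tree \<Rightarrow> 'v \<Rightarrow> 'v set" where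
  "children T v = {w. is_child T v w}"

definition descendants :: "'v rooted_tree \<Rightarrow> 'v \<Rightarrow> 'v set" where
  "descendants T v = {w. (is_child T)\<^sup>*\<^sup>* v w}"

text \<open>
  The number of children is compared by \<open>\<approx>\<close>, since \<^const>\<open>card\<close> does not distinguish infinite
  cardinalities.  Local finiteness is not required here; it holds for any tree carrying a branch
  group, because the rigid level stabilizers fix the levels pointwise and have finite index.
\<close>

definition spherically_regular :: "'v rooted_tree \<Rightarrow> bool" where
  "spherically_regular T \<longleftrightarrow> (\<forall>n. \<forall>u\<in>level T n. \<forall>w\<in>level T n. children T u \<approx> children T w)"

definition branching :: "'v rooted_tree \<Rightarrow> bool" where
  "branching T \<longleftrightarrow> (\<forall>v. \<exists>a\<in>children T v. \<exists>b\<in>children T v. a \<noteq> b)"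

section \<open>The automorphism group\<close>

definition tree_automorphisms :: "'v rooted_tree \<Rightarrow> ('v \<Rightarrow> 'v) set" where
  "tree_automorphisms T =
     {g. bij g \<and> g (tree_root T) = tree_root T \<and>
         (\<forall>u w. adjacent T (g u) (g w) \<longleftrightarrow> adjacent T u w)}"

definition Aut :: "'v rooted_tree \<Rightarrow> ('v \<Rightarrow> 'v) monoid" where
  "Aut T = (BijGroup UNIV)\<lparr>carrier := tree_automorphisms T\<rparr>"

lemma subgroup_tree_automorphisms: "subgroup (tree_automorphisms T) (BijGroup UNIV)"
proof (rule group.subgroupI[OF group_BijGroup])
  show "tree_automorphisms T \<subseteq> carrier (BijGroup UNIV)"
    by (auto simp: tree_automorphisms_def BijGroup_def Bij_def)
  show "tree_automorphisms T \<noteq> {}"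
  proof -
    have "id \<in> tree_automorphisms T" by (simp add: tree_automorphisms_def)
    then show ?thesis by blast
  qed
next
  fix g assume g: "g \<in> tree_automorphisms T"
  then have b: "bij g" by (simp add: tree_automorphisms_def)
  then have "g \<in> Bij UNIV" by (simp add: Bij_def)
  then have "inv\<^bsub>BijGroup UNIV\<^esub> g = inv_into UNIV g"
    by (simp add: inv_BijGroup restrict_def)
  moreover have "inv_into UNIV g \<in> tree_automorphisms T"
  proof -
    have "adjacent T (inv_into UNIV g u) (inv_into UNIV g w) \<longleftrightarrow> adjacent T u w" for u w
    proof -
      have "adjacent T (g (inv_into UNIV g u)) (g (inv_into UNIV g w)) \<longleftrightarrow>
            adjacent T (inv_into UNIV g u) (inv_into UNIV g w)"
        using g by (simp add: tree_automorphisms_def)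
      then show ?thesis using b by (simp add: surj_f_inv_f bij_is_surj)
    qed
    moreover have "inv_into UNIV g (tree_root T) = tree_root T"
      using g b by (auto simp: tree_automorphisms_def intro: inv_f_eq bij_is_inj)
    ultimately show ?thesis using b by (simp add: tree_automorphisms_def bij_imp_bij_inv)
  qed
  ultimately show "inv\<^bsub>BijGroup UNIV\<^esub> g \<in> tree_automorphisms T" by simp
next
  fix g h assume "g \<in> tree_automorphisms T" "h \<in> tree_automorphisms T"
  then show "g \<otimes>\<^bsub>BijGroup UNIV\<^esub> h \<in> tree_automorphisms T"
    by (auto simp: tree_automorphisms_def BijGroup_def Bij_def compose_def bij_comp[unfolded comp_def])
qed

lemma group_Aut: "group (Aut T)"
  unfolding Aut_def
  by (rule subgroup.subgroup_is_group[OF subgroup_tree_automorphisms group_BijGroup])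

text \<open>Group-theoretic notions below take subgroups of \<open>Aut T\<close> as sets of automorphisms.\<close>

definition Stab :: "('v \<Rightarrow> 'v) set \<Rightarrow> 'v \<Rightarrow> ('v \<Rightarrow> 'v) set" where
  "Stab F v = {g \<in> F. g v = v}"

definition Rist :: "'v rooted_tree \<Rightarrow> ('v \<Rightarrow> 'v) set \<Rightarrow> 'v \<Rightarrow> ('v \<Rightarrow> 'v) set" where
  "Rist T G v = {g \<in> G. \<forall>w. w \<notin> descendants T v \<longrightarrow> g w = w}"

text \<open>The rigid stabilizers of distinct vertices of one level commute and intersect trivially, so
  their internal product is the subgroup they generate.\<close>

definition Rist_level :: "'v rooted_tree \<Rightarrow> ('v \<Rightarrow> 'v) set \<Rightarrow> nat \<Rightarrow> ('v \<Rightarrow> 'v) set" where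
  "Rist_level T G n = generate (Aut T) (\<Union>v\<in>level T n. Rist T G v)"

definition branch_group :: "'v rooted_tree \<Rightarrow> ('v \<Rightarrow> 'v) set \<Rightarrow> bool" where
  "branch_group T G \<longleftrightarrow>
     subgroup G (Aut T) \<and>
     (\<forall>n. (\<forall>u\<in>level T n. \<forall>w\<in>level T n. \<exists>g\<in>G. g u = w) \<and>
          finite (rcosets\<^bsub>(Aut T)\<lparr>carrier := G\<rparr>\<^esub> (Rist_level T G n)))"

section \<open>The boundary\<close>

definition rays :: "'v rooted_tree \<Rightarrow> (nat \<Rightarrow> 'v) set" where
  "rays T = {\<xi>. \<xi> 0 = tree_root T \<and> (\<forall>n. is_child T (\<xi> n) (\<xi> (Suc n)))}"

definition ray_dist :: "(nat \<Rightarrow> 'v) \<Rightarrow> (nat \<Rightarrow> 'v) \<Rightarrow> real" where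
  "ray_dist \<xi> \<eta> = (if \<xi> = \<eta> then 0 else (1 / 2) ^ (LEAST i. \<xi> i \<noteq> \<eta> i))"

lemma Metric_space_rays: "Metric_space (rays T) ray_dist"
proof
  fix \<xi> \<eta> \<zeta> :: "nat \<Rightarrow> 'a"
  show "0 \<le> ray_dist \<xi> \<eta>" by (simp add: ray_dist_def)
  have "(\<lambda>i. \<xi> i \<noteq> \<eta> i) = (\<lambda>i. \<eta> i \<noteq> \<xi> i)" by auto
  then show "ray_dist \<xi> \<eta> = ray_dist \<eta> \<xi>" by (auto simp: ray_dist_def)
  show "(ray_dist \<xi> \<eta> = 0) = (\<xi> = \<eta>)" by (simp add: ray_dist_def)
  show "ray_dist \<xi> \<zeta> \<le> ray_dist \<xi> \<eta> + ray_dist \<eta> \<zeta>"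
  proof (cases "\<xi> = \<zeta> \<or> \<xi> = \<eta> \<or> \<eta> = \<zeta>")
    case True
    then show ?thesis by (auto simp: ray_dist_def)
  next
    case False
    define i where "i = (LEAST i. \<xi> i \<noteq> \<zeta> i)"
    define j where "j = (LEAST i. \<xi> i \<noteq> \<eta> i)"
    define k where "k = (LEAST i. \<eta> i \<noteq> \<zeta> i)"
    have "\<xi> i \<noteq> \<zeta> i" unfolding i_def by (rule LeastI_ex) (use False in \<open>auto simp: fun_eq_iff\<close>)
    then have "\<xi> i \<noteq> \<eta> i \<or> \<eta> i \<noteq> \<zeta> i" by auto
    then have "j \<le> i \<or> k \<le> i" unfolding j_def k_def by (auto intro: Least_le)
    then have "(1 / 2 :: real) ^ i \<le> (1 / 2) ^ j \<or> (1 / 2 :: real) ^ i \<le> (1 / 2) ^ k"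
      by (auto intro: power_decreasing)
    then have "(1 / 2 :: real) ^ i \<le> (1 / 2) ^ j + (1 / 2) ^ k"
      by (smt (verit) zero_le_power divide_nonneg_nonneg)
    then show ?thesis using False by (simp add: ray_dist_def i_def j_def k_def)
  qed
qed

definition boundary :: "'v rooted_tree \<Rightarrow> (nat \<Rightarrow> 'v) topology" where
  "boundary T = Metric_space.mtopology (rays T) ray_dist"

lemma topspace_boundary: "topspace (boundary T) = rays T"
  by (simp add: boundary_def Metric_space.topspace_mtopology[OF Metric_space_rays])

text \<open>An automorphism \<open>g\<close> acts on rays by \<open>\<xi> \<mapsto> g \<circ> \<xi>\<close>.\<close>

definition ray_orbit :: "('v \<Rightarrow> 'v) set \<Rightarrow> (nat \<Rightarrow> 'v) \<Rightarrow> (nat \<Rightarrow> 'v) set" where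
  "ray_orbit H \<xi> = (\<lambda>g. g \<circ> \<xi>) ` H"

definition SStab :: "('v \<Rightarrow> 'v) set \<Rightarrow> (nat \<Rightarrow> 'v) set \<Rightarrow> ('v \<Rightarrow> 'v) set" where
  "SStab G C = {g \<in> G. (\<lambda>\<xi>. g \<circ> \<xi>) ` C = C}"

definition minimal_action ::
  "'v rooted_tree \<Rightarrow> ('v \<Rightarrow> 'v) set \<Rightarrow> (nat \<Rightarrow> 'v) set \<Rightarrow> bool" where
  "minimal_action T H C \<longleftrightarrow>
     (\<forall>\<xi>\<in>C. subtopology (boundary T) C closure_of ray_orbit H \<xi> = C)"

definition generalized_parabolic ::
  "'v rooted_tree \<Rightarrow> ('v \<Rightarrow> 'v) set \<Rightarrow> ('v \<Rightarrow> 'v) set \<Rightarrow> bool" where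
  "generalized_parabolic T G H \<longleftrightarrow>
     (\<exists>C. closedin (boundary T) C \<and> \<not> openin (boundary T) C \<and>
          minimal_action T (SStab G C) C \<and> H = SStab G C)"

definition parabolic ::
  "'v rooted_tree \<Rightarrow> ('v \<Rightarrow> 'v) set \<Rightarrow> ('v \<Rightarrow> 'v) set \<Rightarrow> bool" where
  "parabolic T G H \<longleftrightarrow> (\<exists>\<xi>\<in>rays T. H = {g \<in> G. g \<circ> \<xi> = \<xi>})"

definition continuum :: "'a set \<Rightarrow> bool" where
  "continuum A \<longleftrightarrow> A \<approx> (UNIV :: nat set set)"

end

(* For a ray xi let C be the closure of its F-orbit.  The closures of F-orbits partition the boundary
   and F acts minimally on each, so SStab_G(C) is a generalized parabolic subgroup containing F as
   soon as C is not open.  Levels are finite, so Stab_F(v) has finite index in F and C is a finite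
   union of translates of a Stab_F(v)-orbit-closure; a non-open orbit closure is nowhere dense, hence
   so is C.

   Distinct nowhere dense closures C have distinct stabilizers: if xi lies in C' but not in C, choose
   u on xi below which C has no ray; then Rist_G(u) lies in SStab_G(C), but the orbit of xi under
   Rist_G(u) is somewhere dense because the level rigid stabilizer has finite index in the level
   transitive group G, so Rist_G(u) cannot preserve C'.

   Part (1) is now the Baire category theorem.  In part (2) the closures C are countable, so the
   2^aleph_0 rays through any vertex meet 2^aleph_0 of them; rays through a vertex moved by F yield
   closures with more than one point, and these are not stabilizers of rays. *)

theory Submission
  imports Defs
begin

lemma uncountable_UNIV_nat_set: "uncountable (UNIV :: nat set set)"
  using Cantors_theorem[of "UNIV :: nat set"] by (metis Pow_UNIV UNIV_not_empty range_from_nat_into)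

section \<open>Groups of tree automorphisms\<close>

lemma bij_tree_automorphism: "g \<in> tree_automorphisms T \<Longrightarrow> bij g"
  by (simp add: tree_automorphisms_def)

lemma inv_tree_automorphism:
  assumes "g \<in> tree_automorphisms T"
  shows "inv_into UNIV g (g x) = x" "g (inv_into UNIV g x) = x"
  using bij_tree_automorphism[OF assms]
  by (simp_all add: bij_is_inj bij_is_surj surj_f_inv_f)

lemma one_Aut: "\<one>\<^bsub>Aut T\<^esub> = id"
  by (auto simp: Aut_def BijGroup_def)

lemma mult_Aut:
  assumes "g \<in> tree_automorphisms T" "h \<in> tree_automorphisms T"
  shows "g \<otimes>\<^bsub>Aut T\<^esub> h = g \<circ> h"
  using assms by (auto simp: Aut_def BijGroup_def Bij_def tree_automorphisms_def compose_def)

lemma inv_Aut: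
  assumes "g \<in> tree_automorphisms T"
  shows "inv\<^bsub>Aut T\<^esub> g = inv_into UNIV g"
proof -
  have "inv\<^bsub>Aut T\<^esub> g = inv\<^bsub>BijGroup UNIV\<^esub> g"
    unfolding Aut_def
    by (rule group.m_inv_consistent[OF group_BijGroup subgroup_tree_automorphisms assms])
  also have "g \<in> Bij UNIV"
    using assms by (simp add: Bij_def tree_automorphisms_def)
  then have "inv\<^bsub>BijGroup UNIV\<^esub> g = inv_into UNIV g"
    by (simp add: inv_BijGroup restrict_def)
  finally show ?thesis .
qed

lemma carrier_Aut: "carrier (Aut T) = tree_automorphisms T"
  by (simp add: Aut_def)

lemma subgroup_Aut_subset: "subgroup S (Aut T) \<Longrightarrow> S \<subseteq> tree_automorphisms T"
  using subgroup.subset carrier_Aut by metis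

lemma subgroup_Aut_automorphism: "subgroup S (Aut T) \<Longrightarrow> g \<in> S \<Longrightarrow> g \<in> tree_automorphisms T"
  using subgroup_Aut_subset by blast

lemma subgroup_Aut_id: "subgroup S (Aut T) \<Longrightarrow> id \<in> S"
  using subgroup.one_closed one_Aut by metis

lemma subgroup_Aut_comp: "subgroup S (Aut T) \<Longrightarrow> g \<in> S \<Longrightarrow> h \<in> S \<Longrightarrow> g \<circ> h \<in> S"
  using subgroup.m_closed mult_Aut subgroup_Aut_automorphism by metis

lemma subgroup_Aut_inv: "subgroup S (Aut T) \<Longrightarrow> g \<in> S \<Longrightarrow> inv_into UNIV g \<in> S"
  using subgroup.m_inv_closed inv_Aut subgroup_Aut_automorphism by metis

lemma inv_into_automorphism:
  assumes "g \<in> tree_automorphisms T"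
  shows "inv_into UNIV g \<in> tree_automorphisms T"
  using subgroup_Aut_inv[OF group.subgroup_self[OF group_Aut]] assms by (simp add: carrier_Aut)

lemma subgroup_AutI:
  assumes "S \<subseteq> tree_automorphisms T" "id \<in> S"
    and "\<And>g h. g \<in> S \<Longrightarrow> h \<in> S \<Longrightarrow> g \<circ> h \<in> S"
    and "\<And>g. g \<in> S \<Longrightarrow> inv_into UNIV g \<in> S"
  shows "subgroup S (Aut T)"
proof (rule group.subgroupI[OF group_Aut])
  show "S \<subseteq> carrier (Aut T)" using assms by (simp add: carrier_Aut)
  show "S \<noteq> {}" using assms by blast
  show "inv\<^bsub>Aut T\<^esub> g \<in> S" if "g \<in> S" for g
    using that assms by (metis inv_Aut subsetD)
  show "g \<otimes>\<^bsub>Aut T\<^esub> h \<in> S" if "g \<in> S" "h \<in> S" for g h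
    using that assms by (metis mult_Aut subsetD)
qed

lemma subgroup_Stab:
  assumes "subgroup S (Aut T)"
  shows "subgroup (Stab S x) (Aut T)"
proof (rule subgroup_AutI)
  show "Stab S x \<subseteq> tree_automorphisms T"
    using subgroup_Aut_subset[OF assms] by (auto simp: Stab_def)
  show "inv_into UNIV g \<in> Stab S x" if "g \<in> Stab S x" for g
    using that subgroup_Aut_inv[OF assms] inv_tree_automorphism(1) subgroup_Aut_automorphism[OF assms]
    unfolding Stab_def by (metis (mono_tags, lifting) mem_Collect_eq)
qed (auto simp: Stab_def subgroup_Aut_id[OF assms] subgroup_Aut_comp[OF assms])

lemma subgroup_Rist:
  assumes "subgroup S (Aut T)"
  shows "subgroup (Rist T S x) (Aut T)"
proof (rule subgroup_AutI)
  show "Rist T S x \<subseteq> tree_automorphisms T"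
    using subgroup_Aut_subset[OF assms] by (auto simp: Rist_def)
  show "inv_into UNIV g \<in> Rist T S x" if "g \<in> Rist T S x" for g
    using that subgroup_Aut_inv[OF assms] inv_tree_automorphism(1) subgroup_Aut_automorphism[OF assms]
    unfolding Rist_def by (smt (verit) mem_Collect_eq)
qed (auto simp: Rist_def subgroup_Aut_id[OF assms] subgroup_Aut_comp[OF assms])

lemma subgroup_Rist_level:
  assumes "subgroup S (Aut T)"
  shows "subgroup (Rist_level T S n) (Aut T)"
  unfolding Rist_level_def
  by (rule group.generate_is_subgroup[OF group_Aut])
    (use subgroup_Aut_subset[OF assms] in \<open>auto simp: Rist_def carrier_Aut\<close>)

text \<open>Orbit-stabilizer: elements of \<open>F\<close> with the same value at \<open>v\<close>
  differ by an element of \<open>Stab F v\<close> on the right, so finitely many elements reaching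
  every point of the orbit represent all left cosets.\<close>

lemma Stab_cosets_orbit:
  assumes F: "subgroup F (Aut T)" and fin: "finite ((\<lambda>f. f v) ` F)"
  obtains R where "finite R" "R \<subseteq> F" "F = (\<Union>f\<in>R. (\<lambda>s. f \<circ> s) ` Stab F v)"
proof -
  obtain R where R: "R \<subseteq> F" "finite R" "(\<lambda>f. f v) ` F = (\<lambda>f. f v) ` R"
    using finite_subset_image[OF fin subset_refl] by blast
  have "F = (\<Union>f\<in>R. (\<lambda>s. f \<circ> s) ` Stab F v)"
  proof
    show "F \<subseteq> (\<Union>f\<in>R. (\<lambda>s. f \<circ> s) ` Stab F v)"
    proof
      fix g assume g: "g \<in> F"
      then obtain f where f: "f \<in> R" "g v = f v" using R(3) by blast
      define s where "s = inv_into UNIV f \<circ> g"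
      have fF: "f \<in> F" using f R by blast
      have "s \<in> Stab F v"
        using f g fF F by (auto simp: s_def Stab_def subgroup_Aut_comp subgroup_Aut_inv
            inv_tree_automorphism(1)[OF subgroup_Aut_automorphism[OF F fF]])
      moreover have "g = f \<circ> s"
        by (simp add: s_def fun_eq_iff inv_tree_automorphism(2)[OF subgroup_Aut_automorphism[OF F fF]])
      ultimately show "g \<in> (\<Union>f\<in>R. (\<lambda>s. f \<circ> s) ` Stab F v)" using f by blast
    qed
    show "(\<Union>f\<in>R. (\<lambda>s. f \<circ> s) ` Stab F v) \<subseteq> F"
      using R F by (auto simp: Stab_def subgroup_Aut_comp)
  qed
  then show thesis by (rule that[OF R(2) R(1)])
qed

lemma SStab_comp_mem: "\<xi> \<in> C \<Longrightarrow> g \<in> SStab G C \<Longrightarrow> g \<circ> \<xi> \<in> C"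
  unfolding SStab_def by blast

lemma ray_orbit_mono: "H \<subseteq> K \<Longrightarrow> ray_orbit H \<xi> \<subseteq> ray_orbit K \<xi>"
  by (auto simp: ray_orbit_def)

section \<open>Rays of a branching tree\<close>

locale branching_tree =
  fixes T :: "'v rooted_tree"
  assumes rooted: "rooted_tree T" and branching: "branching T"
begin

lemma not_child_root: "\<not> is_child T u (tree_root T)"
  using rooted by (simp add: rooted_tree_def)

lemma parent_unique: "is_child T u w \<Longrightarrow> is_child T u' w \<Longrightarrow> u = u'"
  using rooted unfolding rooted_tree_def by blast

lemma level_0: "level T 0 = {tree_root T}"
  by (auto simp: level_def)

lemma level_Suc: "w \<in> level T (Suc n) \<longleftrightarrow> (\<exists>u\<in>level T n. is_child T u w)"
  by (auto simp: level_def)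

lemma level_unique: "u \<in> level T n \<Longrightarrow> u \<in> level T m \<Longrightarrow> n = m"
proof (induction n arbitrary: u m)
  case 0
  then show ?case by (cases m) (auto simp: level_0 level_Suc not_child_root)
next
  case (Suc n)
  then show ?case
    by (cases m) (auto simp: level_0 level_Suc not_child_root dest: parent_unique)
qed

lemma in_some_level: "\<exists>n. u \<in> level T n"
proof -
  have "(is_child T)\<^sup>*\<^sup>* (tree_root T) u" using rooted by (simp add: rooted_tree_def)
  then show ?thesis by (auto simp: level_def rtranclp_power)
qed

lemma ray_level: "\<xi> \<in> rays T \<Longrightarrow> \<xi> n \<in> level T n"
  by (induction n) (auto simp: rays_def level_0 level_Suc)

text \<open>Parents are unique, so a vertex determines the whole path that leads to it from the
  root.\<close>

lemma rays_agree:
  assumes "\<xi> \<in> rays T" "\<eta> \<in> rays T" "\<xi> n = \<eta> n" "m \<le> n"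
  shows "\<xi> m = \<eta> m"
  using assms(4)
proof (induction rule: inc_induct)
  case (step k)
  then show ?case using assms(1,2) parent_unique unfolding rays_def by (metis (lifting) mem_Collect_eq)
qed (rule assms)

text \<open>Going back from \<open>\<zeta> m\<close> to \<open>u\<close> parent by parent retraces
  the ray, and the level of \<open>u\<close> tells at which index it is met.\<close>

lemma ray_meets_descendants:
  assumes \<zeta>: "\<zeta> \<in> rays T" and u: "u \<in> level T n" and d: "\<zeta> m \<in> descendants T u"
  shows "\<zeta> n = u"
proof -
  have "(is_child T)\<^sup>*\<^sup>* u w \<Longrightarrow> \<zeta> m = w \<Longrightarrow> \<zeta> n = u" for w
  proof (induction arbitrary: m rule: rtranclp_induct)
    case base
    then show ?case using u ray_level[OF \<zeta>] level_unique by metis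
  next
    case (step y z)
    then obtain m' where m: "m = Suc m'"
      using \<zeta> not_child_root by (cases m) (auto simp: rays_def)
    then have "is_child T (\<zeta> m') z" using \<zeta> step.prems by (auto simp: rays_def)
    then show ?case using step parent_unique by blast
  qed
  then show ?thesis using d by (auto simp: descendants_def)
qed

text \<open>Subsets of \<open>\<nat>\<close> are coded by binary choices among the children met along the ray.\<close>

lemma nat_set_lepoll_rays_through:
  assumes u: "u \<in> level T n"
  shows "(UNIV :: nat set set) \<lesssim> {\<xi> \<in> rays T. \<xi> n = u}"
proof -
  obtain p where p: "p 0 = tree_root T" "p n = u" "\<And>i. i < n \<Longrightarrow> is_child T (p i) (p (Suc i))"
    using u unfolding level_def relpowp_fun_conv by blast
  obtain a b where ab: "\<And>x. is_child T x (a x)" "\<And>x. is_child T x (b x)" "\<And>x. a x \<noteq> b x"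
    using branching unfolding branching_def children_def by (metis mem_Collect_eq)
  define q where "q X = rec_nat u (\<lambda>k x. if k \<in> X then a x else b x)" for X
  have q: "q X 0 = u" "q X (Suc k) = (if k \<in> X then a (q X k) else b (q X k))" for X k
    by (simp_all add: q_def)
  \<comment> \<open>The path \<open>p\<close> is followed down to \<open>u\<close>; from there the
    child taken at level \<open>n + k\<close> records whether \<open>k\<close> lies in
    \<open>X\<close>.\<close>
  define r where "r X k = (if k \<le> n then p k else q X (k - n))" for X k
  have "r X \<in> rays T" for X
  proof -
    have "is_child T (r X k) (r X (Suc k))" for k
    proof (cases "k < n")
      case True
      then show ?thesis using p by (simp add: r_def)
    next
      case False
      then have "r X k = q X (k - n)" "r X (Suc k) = q X (Suc (k - n))"
        using p q by (auto simp: r_def Suc_diff_le)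
      then show ?thesis using q ab by simp
    qed
    then show ?thesis using p by (simp add: rays_def r_def)
  qed
  moreover have "r X n = u" for X using p by (simp add: r_def)
  moreover have "inj r"
  proof (rule injI)
    fix X Y assume "r X = r Y"
    moreover have "r Z (n + k) = q Z k" for Z k
      using q(1) p(2) by (cases k) (auto simp: r_def)
    ultimately have e: "q X k = q Y k" for k by metis
    have "k \<in> X \<longleftrightarrow> k \<in> Y" for k
      using e[of k] e[of "Suc k"] q(2) ab(3) by metis
    then show "X = Y" by blast
  qed
  ultimately show ?thesis unfolding lepoll_def by (intro exI[of _ r]) auto
qed

lemma uncountable_rays_through:
  assumes "u \<in> level T n"
  shows "uncountable {\<xi> \<in> rays T. \<xi> n = u}"
proof
  assume "countable {\<xi> \<in> rays T. \<xi> n = u}"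
  then have "countable (UNIV :: nat set set)"
    by (rule countable_lepoll) (rule nat_set_lepoll_rays_through[OF assms])
  then show False
    using uncountable_UNIV_nat_set by contradiction
qed

lemma obtain_ray_through:
  assumes "u \<in> level T n"
  obtains \<xi> where "\<xi> \<in> rays T" "\<xi> n = u"
  using uncountable_rays_through[OF assms] by (metis (mono_tags, lifting) Collect_empty_eq countable_empty)

section \<open>Automorphisms acting on levels and rays\<close>

text \<open>Automorphisms preserve unoriented edges; the orientation follows by induction on the
  level. If the edge from \<open>u\<close> to \<open>w\<close> were reversed, \<open>g w\<close>
  would be the parent of \<open>g u\<close>, which is the image of the parent \<open>p\<close> of
  \<open>u\<close>, so \<open>w = p\<close> by injectivity, against the levels.\<close>

lemma automorphism_is_child:
  assumes g: "g \<in> tree_automorphisms T" and c: "is_child T u w"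
  shows "is_child T (g u) (g w)"
proof -
  have adj: "adjacent T (g u) (g w)" if "is_child T u w" for u w
    using g that by (auto simp: tree_automorphisms_def adjacent_def)
  have root: "g (tree_root T) = tree_root T" using g by (simp add: tree_automorphisms_def)
  have "u \<in> level T n \<Longrightarrow> is_child T u w \<Longrightarrow> is_child T (g u) (g w)" for n
  proof (induction n arbitrary: u w)
    case 0
    then show ?case using adj[of u w] root not_child_root by (auto simp: level_0 adjacent_def)
  next
    case (Suc n)
    then obtain p where p: "p \<in> level T n" "is_child T p u" by (auto simp: level_Suc)
    show ?case
    proof (rule ccontr)
      assume "\<not> is_child T (g u) (g w)"
      then have "is_child T (g w) (g u)" using adj Suc.prems(2) by (auto simp: adjacent_def)
      then have "g w = g p" using Suc.IH[OF p] parent_unique by blast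
      then have "w = p" using bij_tree_automorphism[OF g] by (simp add: bij_is_inj inj_eq)
      then have "w \<in> level T n" using p by simp
      moreover have "w \<in> level T (Suc (Suc n))" using Suc.prems level_Suc by blast
      ultimately show False using level_unique[of w n "Suc (Suc n)"] by simp
    qed
  qed
  then show ?thesis using in_some_level c by blast
qed

lemma automorphism_ray:
  assumes "g \<in> tree_automorphisms T" "\<xi> \<in> rays T"
  shows "g \<circ> \<xi> \<in> rays T"
  using assms automorphism_is_child[OF assms(1)] by (auto simp: rays_def tree_automorphisms_def)

lemma automorphism_level:
  assumes "g \<in> tree_automorphisms T" "u \<in> level T n"
  shows "g u \<in> level T n"
proof -
  obtain \<xi> where \<xi>: "\<xi> \<in> rays T" "\<xi> n = u" using obtain_ray_through[OF assms(2)] .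
  then show ?thesis using ray_level[OF automorphism_ray[OF assms(1) \<xi>(1)], of n] by simp
qed

lemma ray_orbit_subset:
  assumes "subgroup S (Aut T)" "\<xi> \<in> rays T"
  shows "ray_orbit S \<xi> \<subseteq> rays T"
  using assms automorphism_ray subgroup_Aut_automorphism by (fastforce simp: ray_orbit_def)

section \<open>The topology of the boundary\<close>

text \<open>Open balls of radius \<open>(1 / 2) ^ n\<close> are cones, that is, sets of all rays
  through one vertex of level \<open>n\<close>. The inequality is strict because the first
  difference has to come after index \<open>n\<close>.\<close>

lemma ray_dist_less_iff:
  assumes "\<xi> \<in> rays T" "\<eta> \<in> rays T"
  shows "ray_dist \<xi> \<eta> < (1 / 2) ^ n \<longleftrightarrow> \<xi> n = \<eta> n"
proof (cases "\<xi> = \<eta>")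
  case False
  define i where "i = (LEAST i. \<xi> i \<noteq> \<eta> i)"
  have i: "\<xi> i \<noteq> \<eta> i"
    unfolding i_def by (rule LeastI_ex) (use False in \<open>auto simp: fun_eq_iff\<close>)
  have "\<xi> n = \<eta> n \<longleftrightarrow> n < i"
  proof
    show "\<xi> n = \<eta> n" if "n < i" using not_less_Least[of n "\<lambda>i. \<xi> i \<noteq> \<eta> i"] that by (auto simp: i_def)
    show "n < i" if "\<xi> n = \<eta> n" using rays_agree[OF assms that, of i] i by force
  qed
  moreover have "(1 / 2 :: real) ^ i < (1 / 2) ^ n \<longleftrightarrow> n < i"
    by (rule power_strict_decreasing_iff) auto
  ultimately show ?thesis using False by (simp add: ray_dist_def i_def)
qed (simp add: ray_dist_def)

text \<open>Cones replace balls, so that topological arguments become statements about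
  vertices.\<close>

lemma openin_boundary_iff:
  "openin (boundary T) U \<longleftrightarrow>
     U \<subseteq> rays T \<and> (\<forall>\<xi>\<in>U. \<exists>n. \<forall>\<eta>\<in>rays T. \<eta> n = \<xi> n \<longrightarrow> \<eta> \<in> U)"
proof -
  interpret Metric_space "rays T" ray_dist by (rule Metric_space_rays)
  have "(\<exists>r>0. mball \<xi> r \<subseteq> U) \<longleftrightarrow> (\<exists>n. \<forall>\<eta>\<in>rays T. \<eta> n = \<xi> n \<longrightarrow> \<eta> \<in> U)"
    if \<xi>: "\<xi> \<in> rays T" for \<xi>
  proof
    assume "\<exists>r>0. mball \<xi> r \<subseteq> U"
    then obtain r where r: "r > 0" "mball \<xi> r \<subseteq> U" by blast
    obtain n where n: "(1 / 2) ^ n < r" using real_arch_pow_inv[OF r(1), of "1/2"] by auto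
    have "\<eta> \<in> U" if "\<eta> \<in> rays T" "\<eta> n = \<xi> n" for \<eta>
      using ray_dist_less_iff[OF \<xi> that(1), of n] that n r \<xi> by (auto simp: subset_iff)
    then show "\<exists>n. \<forall>\<eta>\<in>rays T. \<eta> n = \<xi> n \<longrightarrow> \<eta> \<in> U" by blast
  next
    assume "\<exists>n. \<forall>\<eta>\<in>rays T. \<eta> n = \<xi> n \<longrightarrow> \<eta> \<in> U"
    then obtain n where n: "\<And>\<eta>. \<eta> \<in> rays T \<Longrightarrow> \<eta> n = \<xi> n \<Longrightarrow> \<eta> \<in> U" by blast
    have "mball \<xi> ((1 / 2) ^ n) \<subseteq> U"
      using n ray_dist_less_iff[OF \<xi>] by (auto simp: mball_def)
    then show "\<exists>r>0. mball \<xi> r \<subseteq> U" by (intro exI[of _ "(1/2)^n"]) auto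
  qed
  then show ?thesis unfolding boundary_def openin_mtopology by blast
qed

text \<open>Cones are neighbourhoods of their rays. The intersection with \<open>rays T\<close> is
  there because \<open>A\<close> may contain sequences of vertices that are not rays.\<close>

lemma closure_of_boundary:
  "boundary T closure_of A = {\<xi> \<in> rays T. \<forall>n. \<exists>\<eta>\<in>A \<inter> rays T. \<eta> n = \<xi> n}" (is "?L = ?R")
proof
  show "?L \<subseteq> ?R"
  proof
    fix \<xi> assume \<xi>: "\<xi> \<in> ?L"
    then have r: "\<xi> \<in> rays T" by (simp add: in_closure_of topspace_boundary)
    have "\<exists>\<eta>\<in>A \<inter> rays T. \<eta> n = \<xi> n" for n
    proof -
      have "openin (boundary T) {\<eta> \<in> rays T. \<eta> n = \<xi> n}"
        unfolding openin_boundary_iff by (auto intro!: exI[of _ n])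
      moreover have "\<xi> \<in> {\<eta> \<in> rays T. \<eta> n = \<xi> n}" using r by simp
      ultimately obtain \<eta> where "\<eta> \<in> A" "\<eta> \<in> {\<eta> \<in> rays T. \<eta> n = \<xi> n}"
        using conjunct2[OF \<xi>[unfolded in_closure_of], rule_format, of "{\<eta> \<in> rays T. \<eta> n = \<xi> n}"]
        by auto
      then have "\<eta> \<in> A \<inter> rays T" "\<eta> n = \<xi> n" by auto
      then show ?thesis by (intro bexI)
    qed
    then show "\<xi> \<in> ?R" using r by simp
  qed
  show "?R \<subseteq> ?L"
  proof
    fix \<xi> assume \<xi>: "\<xi> \<in> ?R"
    have "\<exists>\<eta>\<in>A. \<eta> \<in> U" if U: "openin (boundary T) U" "\<xi> \<in> U" for U
    proof -
      obtain n where n: "\<And>\<eta>. \<eta> \<in> rays T \<Longrightarrow> \<eta> n = \<xi> n \<Longrightarrow> \<eta> \<in> U"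
        using U unfolding openin_boundary_iff by blast
      obtain \<eta> where "\<eta> \<in> A" "\<eta> \<in> rays T" "\<eta> n = \<xi> n" using \<xi> by blast
      then show ?thesis using n by blast
    qed
    then show "\<xi> \<in> ?L" using \<xi> by (auto simp: in_closure_of topspace_boundary)
  qed
qed

lemma closedin_boundary_iff:
  "closedin (boundary T) C \<longleftrightarrow>
     C \<subseteq> rays T \<and> (\<forall>\<xi>\<in>rays T. (\<forall>n. \<exists>\<eta>\<in>C. \<eta> n = \<xi> n) \<longrightarrow> \<xi> \<in> C)"
proof -
  have "closedin (boundary T) C \<longleftrightarrow> C \<subseteq> rays T \<and> boundary T closure_of C \<subseteq> C"
    using closure_of_subset_eq[of C "boundary T"] by (simp add: topspace_boundary)
  then show ?thesis by (auto simp: closure_of_boundary Int_absorb2)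
qed

section \<open>Nowhere dense sets of rays\<close>

text \<open>For \<open>A \<subseteq> rays T\<close> this is nowhere density in \<open>boundary T\<close>.\<close>

definition nowhere_dense_rays :: "(nat \<Rightarrow> 'v) set \<Rightarrow> bool" where
  "nowhere_dense_rays A \<longleftrightarrow>
     (\<forall>\<xi>\<in>rays T. \<forall>n. \<exists>\<eta>\<in>rays T. \<eta> n = \<xi> n \<and> (\<exists>m. \<forall>\<zeta>\<in>A. \<zeta> m \<noteq> \<eta> m))"

lemma nowhere_dense_raysD:
  assumes "nowhere_dense_rays A" "\<xi> \<in> rays T"
  obtains \<eta> m where "\<eta> \<in> rays T" "\<eta> n = \<xi> n" "\<And>\<zeta>. \<zeta> \<in> A \<Longrightarrow> \<zeta> m \<noteq> \<eta> m"
  using assms unfolding nowhere_dense_rays_def by blast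

lemma nowhere_dense_rays_mono:
  assumes "nowhere_dense_rays A" "B \<subseteq> A"
  shows "nowhere_dense_rays B"
  using assms unfolding nowhere_dense_rays_def by (meson subsetD)

text \<open>A cone is shrunk twice, first to miss \<open>A\<close> and then to miss
  \<open>B\<close>. Since both sets consist of rays, missing a vertex implies missing everything
  below it.\<close>

lemma nowhere_dense_rays_Un:
  assumes A: "nowhere_dense_rays A" "A \<subseteq> rays T" and B: "nowhere_dense_rays B" "B \<subseteq> rays T"
  shows "nowhere_dense_rays (A \<union> B)"
  unfolding nowhere_dense_rays_def
proof (intro ballI allI)
  fix \<xi> n assume \<xi>: "\<xi> \<in> rays T"
  obtain \<alpha> k where \<alpha>: "\<alpha> \<in> rays T" "\<alpha> n = \<xi> n" "\<And>\<zeta>. \<zeta> \<in> A \<Longrightarrow> \<zeta> k \<noteq> \<alpha> k"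
    using nowhere_dense_raysD[OF A(1) \<xi>] by blast
  \<comment> \<open>Agreement at level \<open>max n k\<close> keeps \<open>\<beta>\<close> both in
    the given cone and in the cone missed by \<open>A\<close>.\<close>
  obtain \<beta> l where \<beta>: "\<beta> \<in> rays T" "\<beta> (max n k) = \<alpha> (max n k)" "\<And>\<zeta>. \<zeta> \<in> B \<Longrightarrow> \<zeta> l \<noteq> \<beta> l"
    using nowhere_dense_raysD[OF B(1) \<alpha>(1)] by blast
  have nk: "\<beta> n = \<alpha> n" "\<beta> k = \<alpha> k"
    using rays_agree[OF \<beta>(1) \<alpha>(1) \<beta>(2)] by auto
  have "\<zeta> (max k l) \<noteq> \<beta> (max k l)" if "\<zeta> \<in> A \<union> B" for \<zeta>
  proof
    assume e: "\<zeta> (max k l) = \<beta> (max k l)"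
    have "\<zeta> \<in> rays T" using that A B by blast
    then have "\<zeta> k = \<beta> k" "\<zeta> l = \<beta> l" using rays_agree[of \<zeta> \<beta> "max k l"] \<beta>(1) e by auto
    then show False using that \<alpha>(3) \<beta>(3) nk by auto
  qed
  then show "\<exists>\<eta>\<in>rays T. \<eta> n = \<xi> n \<and> (\<exists>m. \<forall>\<zeta>\<in>A \<union> B. \<zeta> m \<noteq> \<eta> m)"
    using \<alpha>(2) \<beta>(1) nk(1) by metis
qed

lemma nowhere_dense_rays_UN:
  assumes "finite I" "\<And>i. i \<in> I \<Longrightarrow> nowhere_dense_rays (A i)" "\<And>i. i \<in> I \<Longrightarrow> A i \<subseteq> rays T"
  shows "nowhere_dense_rays (\<Union>i\<in>I. A i)"
  using assms
proof (induction rule: finite_induct)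
  case empty
  then show ?case by (auto simp: nowhere_dense_rays_def)
next
  case (insert i I)
  have "nowhere_dense_rays (A i \<union> (\<Union>i\<in>I. A i))"
    by (rule nowhere_dense_rays_Un) (use insert in auto)
  then show ?case by simp
qed

lemma nowhere_dense_rays_image:
  assumes g: "g \<in> tree_automorphisms T" and A: "nowhere_dense_rays A"
  shows "nowhere_dense_rays ((\<lambda>\<xi>. g \<circ> \<xi>) ` A)"
  unfolding nowhere_dense_rays_def
proof (intro ballI allI)
  fix \<xi> n assume \<xi>: "\<xi> \<in> rays T"
  have "inv_into UNIV g \<circ> \<xi> \<in> rays T"
    using automorphism_ray[OF _ \<xi>] inv_into_automorphism[OF g] by blast
  then obtain \<eta> m where \<eta>: "\<eta> \<in> rays T" "\<eta> n = (inv_into UNIV g \<circ> \<xi>) n"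
    "\<And>\<zeta>. \<zeta> \<in> A \<Longrightarrow> \<zeta> m \<noteq> \<eta> m"
    using nowhere_dense_raysD[OF A] by blast
  have "(g \<circ> \<eta>) n = \<xi> n" using \<eta>(2) inv_tree_automorphism(2)[OF g] by simp
  moreover have "\<zeta> m \<noteq> (g \<circ> \<eta>) m" if "\<zeta> \<in> (\<lambda>\<xi>. g \<circ> \<xi>) ` A" for \<zeta>
    using that \<eta>(3) bij_tree_automorphism[OF g] by (auto simp: bij_is_inj inj_eq)
  ultimately show "\<exists>\<eta>\<in>rays T. \<eta> n = \<xi> n \<and> (\<exists>m. \<forall>\<zeta>\<in>(\<lambda>\<xi>. g \<circ> \<xi>) ` A. \<zeta> m \<noteq> \<eta> m)"
    using automorphism_ray[OF g \<eta>(1)] by blast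
qed

text \<open>A limit of \<open>A\<close> shares each of its vertices with some ray of
  \<open>A\<close>, so the closure misses the same cones as \<open>A\<close>.\<close>

lemma nowhere_dense_rays_closure:
  assumes "nowhere_dense_rays A"
  shows "nowhere_dense_rays (boundary T closure_of A)"
  unfolding nowhere_dense_rays_def
proof (intro ballI allI)
  fix \<xi> n assume \<xi>: "\<xi> \<in> rays T"
  obtain \<eta> m where \<eta>: "\<eta> \<in> rays T" "\<eta> n = \<xi> n" "\<And>\<zeta>. \<zeta> \<in> A \<Longrightarrow> \<zeta> m \<noteq> \<eta> m"
    using nowhere_dense_raysD[OF assms \<xi>] by blast
  have "\<zeta> m \<noteq> \<eta> m" if "\<zeta> \<in> boundary T closure_of A" for \<zeta>
  proof -
    obtain \<zeta>' where "\<zeta>' \<in> A" "\<zeta>' m = \<zeta> m" using \<open>\<zeta> \<in> _\<close> unfolding closure_of_boundary by blast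
    then show ?thesis using \<eta>(3) by metis
  qed
  then show "\<exists>\<eta>\<in>rays T. \<eta> n = \<xi> n \<and> (\<exists>m. \<forall>\<zeta>\<in>boundary T closure_of A. \<zeta> m \<noteq> \<eta> m)"
    using \<eta> by blast
qed

lemma nowhere_dense_rays_not_open:
  assumes "nowhere_dense_rays A" "\<xi> \<in> A"
  shows "\<not> openin (boundary T) A"
proof
  assume "openin (boundary T) A"
  then obtain n where \<xi>: "\<xi> \<in> rays T" and n: "\<And>\<eta>. \<eta> \<in> rays T \<Longrightarrow> \<eta> n = \<xi> n \<Longrightarrow> \<eta> \<in> A"
    using assms(2) unfolding openin_boundary_iff by blast
  show False using nowhere_dense_raysD[OF assms(1) \<xi>] n by metis
qed

text \<open>Baire category by nested cones. A pair of a ray and a level stands for the cone at that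
  vertex of the ray; \<open>Q i\<close> says that the second cone lies strictly deeper inside the
  first and misses \<open>A i\<close>. The nested cones determine a ray outside all
  \<open>A i\<close>.\<close>

lemma rays_Baire:
  fixes A :: "nat \<Rightarrow> (nat \<Rightarrow> 'v) set"
  assumes nd: "\<And>i. nowhere_dense_rays (A i)" and sub: "\<And>i. A i \<subseteq> rays T"
  shows "\<not> rays T \<subseteq> (\<Union>i. A i)"
proof -
  define Q where "Q i s t \<longleftrightarrow> snd s < snd t \<and> fst t (snd s) = fst s (snd s) \<and>
      (\<forall>\<zeta>\<in>A i. \<zeta> (snd t) \<noteq> fst t (snd t))" for i and s t :: "(nat \<Rightarrow> 'v) \<times> nat"
  have step: "\<exists>t. fst t \<in> rays T \<and> Q i s t" if s: "fst s \<in> rays T" for s i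
  proof -
    obtain \<eta> m where \<eta>: "\<eta> \<in> rays T" "\<eta> (snd s) = fst s (snd s)" "\<And>\<zeta>. \<zeta> \<in> A i \<Longrightarrow> \<zeta> m \<noteq> \<eta> m"
      using nowhere_dense_raysD[OF nd[of i] s] by blast
    \<comment> \<open>The level is pushed beyond \<open>snd s\<close>, so that the levels of the
      cones tend to infinity.\<close>
    have "\<zeta> (max m (Suc (snd s))) \<noteq> \<eta> (max m (Suc (snd s)))" if "\<zeta> \<in> A i" for \<zeta>
      using rays_agree[of \<zeta> \<eta> "max m (Suc (snd s))" m] \<eta> that sub by auto
    then have "Q i s (\<eta>, max m (Suc (snd s)))" using \<eta>(2) by (auto simp: Q_def)
    then show ?thesis using \<eta>(1) by (metis fst_conv)
  qed
  have "\<exists>s. fst s \<in> rays T"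
    using obtain_ray_through[of "tree_root T" 0] by (auto simp: level_0)
  then obtain f where f: "\<And>i. fst (f i) \<in> rays T" "\<And>i. Q i (f i) (f (Suc i))"
    using dependent_nat_choice[of "\<lambda>_ s. fst s \<in> rays T" Q] step by metis
  define \<rho> l where "\<rho> i = fst (f i)" and "l i = snd (f i)" for i
  have \<rho>: "\<rho> i \<in> rays T" "l i < l (Suc i)" "\<rho> (Suc i) (l i) = \<rho> i (l i)"
    "\<And>\<zeta>. \<zeta> \<in> A i \<Longrightarrow> \<zeta> (l (Suc i)) \<noteq> \<rho> (Suc i) (l (Suc i))" for i
    using f[of i] unfolding Q_def \<rho>_def l_def by auto
  have "strict_mono l" using \<rho>(2) by (simp add: strict_mono_Suc_iff)
  then have l: "i \<le> l i" "i \<le> j \<Longrightarrow> l i \<le> l j" for i j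
    by (simp_all add: strict_mono_imp_increasing strict_mono_less_eq)
  have agree: "\<rho> j k = \<rho> i k" if "i \<le> j" "k \<le> l i" for i j k
    using that(1)
  proof (induction rule: dec_induct)
    case (step j)
    have "\<rho> (Suc j) k = \<rho> j k"
      by (rule rays_agree[OF \<rho>(1) \<rho>(1) \<rho>(3)]) (use that(2) l(2)[OF step(1)] in simp)
    then show ?case using step by simp
  qed simp
  \<comment> \<open>As \<open>k \<le> l k\<close>, all \<open>\<rho> j\<close> with
    \<open>j \<ge> k\<close> have the same vertex at index \<open>k\<close>; the diagonal is their
    limit.\<close>
  define \<sigma> where "\<sigma> k = \<rho> k k" for k
  have \<sigma>: "\<sigma> k = \<rho> i k" if "k \<le> l i" for i k
    using agree[of i k k] agree[of k i k] that l(1)[of k] unfolding \<sigma>_def by (metis nat_le_linear)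
  have "\<sigma> \<in> rays T"
  proof -
    have "is_child T (\<sigma> k) (\<sigma> (Suc k))" for k
    proof -
      have "\<sigma> k = \<rho> (Suc k) k" "\<sigma> (Suc k) = \<rho> (Suc k) (Suc k)"
        using \<sigma>[of k "Suc k"] \<sigma>[of "Suc k" "Suc k"] l(1)[of "Suc k"] by auto
      then show ?thesis using \<rho>(1)[of "Suc k"] by (simp add: rays_def)
    qed
    moreover have "\<sigma> 0 = tree_root T" using \<rho>(1)[of 0] by (simp add: \<sigma>_def rays_def)
    ultimately show ?thesis by (simp add: rays_def)
  qed
  moreover have "\<sigma> \<notin> A i" for i
    using \<rho>(4)[of \<sigma> i] \<sigma>[of "l (Suc i)" "Suc i"] by auto
  ultimately show ?thesis by blast
qed

section \<open>Orbit closures\<close>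

abbreviation orbit_closure :: "('v \<Rightarrow> 'v) set \<Rightarrow> (nat \<Rightarrow> 'v) \<Rightarrow> (nat \<Rightarrow> 'v) set" where
  "orbit_closure S \<xi> \<equiv> Abstract_Topology.closure_of (boundary T) (ray_orbit S \<xi>)"

text \<open>Being in the closure means lying in the same \<open>S\<close>-orbit of vertices at every
  level, with a group element that may change with the level.\<close>

lemma orbit_closure_iff:
  assumes "subgroup S (Aut T)" "\<xi> \<in> rays T"
  shows "\<eta> \<in> orbit_closure S \<xi> \<longleftrightarrow> \<eta> \<in> rays T \<and> (\<forall>n. \<exists>g\<in>S. g (\<xi> n) = \<eta> n)"
  using ray_orbit_subset[OF assms]
  by (auto simp: closure_of_boundary Int_absorb2 ray_orbit_def)

lemma mem_orbit_closure:
  assumes "subgroup S (Aut T)" "\<xi> \<in> rays T"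
  shows "\<xi> \<in> orbit_closure S \<xi>"
  unfolding orbit_closure_iff[OF assms] using assms(2) subgroup_Aut_id[OF assms(1)]
  by (auto intro!: bexI[of _ id])

lemma orbit_closure_subset_rays: "orbit_closure S \<xi> \<subseteq> rays T"
  by (auto simp: closure_of_boundary)

text \<open>Lying in one vertex orbit is an equivalence relation at each level. Transitivity here
  and symmetry below make the orbit closures a partition of the boundary.\<close>

lemma orbit_closure_trans:
  assumes S: "subgroup S (Aut T)" and \<xi>: "\<xi> \<in> rays T"
    and \<eta>: "\<eta> \<in> orbit_closure S \<xi>" and \<zeta>: "\<zeta> \<in> orbit_closure S \<eta>"
  shows "\<zeta> \<in> orbit_closure S \<xi>"
proof -
  have \<eta>': "\<eta> \<in> rays T" "\<And>n. \<exists>g\<in>S. g (\<xi> n) = \<eta> n"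
    using \<eta> orbit_closure_iff[OF S \<xi>] by auto
  have \<zeta>': "\<zeta> \<in> rays T" "\<And>n. \<exists>g\<in>S. g (\<eta> n) = \<zeta> n"
    using \<zeta> orbit_closure_iff[OF S \<eta>'(1)] by auto
  have "\<exists>g\<in>S. g (\<xi> n) = \<zeta> n" for n
  proof -
    obtain g h where "g \<in> S" "g (\<xi> n) = \<eta> n" "h \<in> S" "h (\<eta> n) = \<zeta> n"
      using \<eta>'(2) \<zeta>'(2) by blast
    then show ?thesis using subgroup_Aut_comp[OF S, of h g] by (intro bexI[of _ "h \<circ> g"]) auto
  qed
  then show ?thesis using orbit_closure_iff[OF S \<xi>] \<zeta>'(1) by blast
qed

lemma orbit_closure_sym:
  assumes S: "subgroup S (Aut T)" and \<xi>: "\<xi> \<in> rays T" and \<eta>: "\<eta> \<in> orbit_closure S \<xi>"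
  shows "\<xi> \<in> orbit_closure S \<eta>"
proof -
  have \<eta>': "\<eta> \<in> rays T" "\<And>n. \<exists>g\<in>S. g (\<xi> n) = \<eta> n"
    using \<eta> orbit_closure_iff[OF S \<xi>] by auto
  have "\<exists>g\<in>S. g (\<eta> n) = \<xi> n" for n
  proof -
    obtain g where g: "g \<in> S" "g (\<xi> n) = \<eta> n" using \<eta>'(2) by blast
    then have "inv_into UNIV g (\<eta> n) = \<xi> n"
      using inv_tree_automorphism(1)[OF subgroup_Aut_automorphism[OF S g(1)]] by metis
    then show ?thesis using subgroup_Aut_inv[OF S g(1)] by blast
  qed
  then show ?thesis using orbit_closure_iff[OF S \<eta>'(1)] \<xi> by blast
qed

lemma orbit_closure_eq:
  assumes S: "subgroup S (Aut T)" and \<xi>: "\<xi> \<in> rays T" and \<eta>: "\<eta> \<in> orbit_closure S \<xi>"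
  shows "orbit_closure S \<eta> = orbit_closure S \<xi>"
proof -
  have "\<eta> \<in> rays T" using \<eta> orbit_closure_subset_rays by blast
  then show ?thesis
    using orbit_closure_trans[OF S] orbit_closure_sym[OF S \<xi> \<eta>] \<xi> \<eta> by blast
qed

lemma comp_mem_orbit_closure:
  assumes S: "subgroup S (Aut T)" and \<xi>: "\<xi> \<in> rays T"
    and g: "g \<in> S" and \<eta>: "\<eta> \<in> orbit_closure S \<xi>"
  shows "g \<circ> \<eta> \<in> orbit_closure S \<xi>"
proof -
  have r: "\<eta> \<in> rays T" using \<eta> orbit_closure_subset_rays by blast
  have "g \<circ> \<eta> \<in> rays T" using automorphism_ray[OF subgroup_Aut_automorphism[OF S g] r] .
  then have "g \<circ> \<eta> \<in> orbit_closure S \<eta>" using g orbit_closure_iff[OF S r] by auto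
  then show ?thesis using orbit_closure_trans[OF S \<xi> \<eta>] by blast
qed

text \<open>If the orbit is dense in some cone, its closure contains that cone. Every point of the
  closure can be moved into the cone by \<open>S\<close>, so pulling the cone back gives a
  neighbourhood of the point inside the closure, which is then open.\<close>

lemma nowhere_dense_orbit:
  assumes S: "subgroup S (Aut T)" and \<xi>: "\<xi> \<in> rays T"
    and not_open: "\<not> openin (boundary T) (orbit_closure S \<xi>)"
  shows "nowhere_dense_rays (ray_orbit S \<xi>)"
proof (rule ccontr)
  assume "\<not> nowhere_dense_rays (ray_orbit S \<xi>)"
  then obtain \<zeta> n where \<zeta>: "\<zeta> \<in> rays T"
    and "\<And>\<eta> m. \<eta> \<in> rays T \<Longrightarrow> \<eta> n = \<zeta> n \<Longrightarrow> \<exists>\<theta>\<in>ray_orbit S \<xi>. \<theta> m = \<eta> m"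
    unfolding nowhere_dense_rays_def by blast
  then have cone: "\<eta> \<in> orbit_closure S \<xi>" if "\<eta> \<in> rays T" "\<eta> n = \<zeta> n" for \<eta>
    using that orbit_closure_iff[OF S \<xi>] unfolding ray_orbit_def by fastforce
  have "\<eta>' \<in> orbit_closure S \<xi>"
    if \<eta>: "\<eta> \<in> orbit_closure S \<xi>" and \<eta>': "\<eta>' \<in> rays T" "\<eta>' n = \<eta> n" for \<eta> \<eta>'
  proof -
    have r: "\<eta> \<in> rays T" using \<eta> orbit_closure_subset_rays by blast
    \<comment> \<open>The orbit of \<open>\<eta>\<close> comes arbitrarily close to
      \<open>\<zeta>\<close>, so some \<open>g\<close> carries the cone at \<open>\<eta> n\<close>
      onto the cone at \<open>\<zeta> n\<close>.\<close>
    have "\<zeta> \<in> orbit_closure S \<eta>"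
      using orbit_closure_trans[OF S r orbit_closure_sym[OF S \<xi> \<eta>]] cone[OF \<zeta>] by blast
    then obtain g where g: "g \<in> S" "g (\<eta> n) = \<zeta> n" using orbit_closure_iff[OF S r] by blast
    note gA = subgroup_Aut_automorphism[OF S g(1)]
    have "g \<circ> \<eta>' \<in> orbit_closure S \<xi>"
      by (rule cone) (use g \<eta>' automorphism_ray[OF gA] in auto)
    then have "inv_into UNIV g \<circ> (g \<circ> \<eta>') \<in> orbit_closure S \<xi>"
      by (rule comp_mem_orbit_closure[OF S \<xi> subgroup_Aut_inv[OF S g(1)]])
    moreover have "inv_into UNIV g \<circ> (g \<circ> \<eta>') = \<eta>'"
      by (simp add: fun_eq_iff inv_tree_automorphism(1)[OF gA])
    ultimately show ?thesis by simp
  qed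
  then have "openin (boundary T) (orbit_closure S \<xi>)"
    unfolding openin_boundary_iff using orbit_closure_subset_rays by blast
  then show False using not_open by contradiction
qed

lemma ray_orbit_cosets:
  assumes "F = (\<Union>f\<in>R. (\<lambda>s. f \<circ> s) ` S)"
  shows "ray_orbit F \<xi> = (\<Union>f\<in>R. (\<lambda>\<eta>. f \<circ> \<eta>) ` ray_orbit S \<xi>)"
  unfolding assms ray_orbit_def by (auto simp: image_UN image_image comp_assoc)

lemma closedin_boundary_image:
  assumes g: "g \<in> tree_automorphisms T" and C: "closedin (boundary T) C"
  shows "closedin (boundary T) ((\<lambda>\<eta>. g \<circ> \<eta>) ` C)"
  unfolding closedin_boundary_iff
proof (intro conjI ballI impI)
  have sub: "C \<subseteq> rays T" using C closedin_boundary_iff by blast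
  then show "(\<lambda>\<eta>. g \<circ> \<eta>) ` C \<subseteq> rays T" using automorphism_ray[OF g] by blast
  fix \<xi> assume \<xi>: "\<xi> \<in> rays T" and lim: "\<forall>n. \<exists>\<eta>\<in>(\<lambda>\<eta>. g \<circ> \<eta>) ` C. \<eta> n = \<xi> n"
  define \<zeta> where "\<zeta> = inv_into UNIV g \<circ> \<xi>"
  have "\<zeta> \<in> rays T"
    unfolding \<zeta>_def using automorphism_ray[OF _ \<xi>] inv_into_automorphism[OF g] by blast
  moreover have "\<exists>\<eta>\<in>C. \<eta> n = \<zeta> n" for n
  proof -
    obtain \<eta> where "\<eta> \<in> C" "g (\<eta> n) = \<xi> n" using lim by auto
    then show ?thesis using inv_tree_automorphism(1)[OF g, of "\<eta> n"] by (auto simp: \<zeta>_def)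
  qed
  ultimately have "\<zeta> \<in> C" using C closedin_boundary_iff by blast
  moreover have "g \<circ> \<zeta> = \<xi>"
    by (simp add: \<zeta>_def fun_eq_iff inv_tree_automorphism(2)[OF g])
  ultimately show "\<xi> \<in> (\<lambda>\<eta>. g \<circ> \<eta>) ` C" by blast
qed

section \<open>Rigid stabilizers\<close>

lemma Rist_fixes_ray:
  assumes "r \<in> Rist T S u" "u \<in> level T n" "\<zeta> \<in> rays T" "\<zeta> n \<noteq> u"
  shows "r \<circ> \<zeta> = \<zeta>"
  using assms ray_meets_descendants[OF assms(3,2)] by (auto simp: Rist_def fun_eq_iff)

text \<open>A vertex \<open>r u\<close> different from \<open>u\<close> lies on a ray that avoids
  \<open>u\<close> at level \<open>n\<close>, hence is fixed by \<open>r\<close>; then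
  \<open>r\<close> takes the same value at \<open>u\<close> and at \<open>r u\<close>.\<close>

lemma Rist_fixes_vertex:
  assumes S: "subgroup S (Aut T)" and r: "r \<in> Rist T S u" and u: "u \<in> level T n"
  shows "r u = u"
proof (rule ccontr)
  assume ne: "r u \<noteq> u"
  note rA = subgroup_Aut_automorphism[OF subgroup_Rist[OF S] r]
  obtain \<zeta> where \<zeta>: "\<zeta> \<in> rays T" "\<zeta> n = r u"
    using obtain_ray_through[OF automorphism_level[OF rA u]] .
  have "r (r u) = r u"
    using Rist_fixes_ray[OF r u \<zeta>(1)] \<zeta>(2) ne by (metis comp_apply)
  then show False using ne bij_tree_automorphism[OF rA] by (simp add: bij_is_inj inj_eq)
qed

text \<open>On a single ray only the factor at its vertex of level \<open>n\<close> is visible,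
  since the generators at other vertices of the level fix the ray.\<close>

lemma Rist_level_on_ray:
  assumes S: "subgroup S (Aut T)" and k: "k \<in> Rist_level T S n" and \<xi>: "\<xi> \<in> rays T"
  shows "\<exists>r\<in>Rist T S (\<xi> n). k \<circ> \<xi> = r \<circ> \<xi>"
proof -
  note sub = subgroup_Rist[OF S]
  have one: "id \<in> Rist T S u" for u using subgroup_Aut_id[OF sub] .
  have gen: "\<exists>r\<in>Rist T S (\<xi> n). h \<circ> \<xi> = r \<circ> \<xi>"
    if "h \<in> Rist T S u" "u \<in> level T n" "\<xi> \<in> rays T" for h u \<xi>
  proof (cases "\<xi> n = u")
    case False
    then have "h \<circ> \<xi> = id \<circ> \<xi>" using Rist_fixes_ray[OF that] by simp
    then show ?thesis using one by blast
  qed (use that in blast)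
  \<comment> \<open>The ray varies in the induction because the left factor of a product acts on the
    ray already moved by the right factor.\<close>
  have "\<exists>r\<in>Rist T S (\<xi> n). k \<circ> \<xi> = r \<circ> \<xi>"
    if "k \<in> generate (Aut T) (\<Union>v\<in>level T n. Rist T S v)" "\<xi> \<in> rays T" for k \<xi>
    using that
  proof (induction arbitrary: \<xi> rule: generate.induct)
    case one
    then show ?case using \<open>\<And>u. id \<in> Rist T S u\<close> one_Aut by metis
  next
    case (incl h)
    then show ?case using gen by blast
  next
    case (inv h)
    then obtain u where u: "u \<in> level T n" "h \<in> Rist T S u" by blast
    have "inv\<^bsub>Aut T\<^esub> h \<in> Rist T S u"
      using subgroup.m_inv_closed[OF sub u(2)] .
    then show ?case using gen u(1) inv.prems by blast
  next
    case (eng h1 h2)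
    obtain r2 where r2: "r2 \<in> Rist T S (\<xi> n)" "h2 \<circ> \<xi> = r2 \<circ> \<xi>" using eng by blast
    have r2\<xi>: "r2 \<circ> \<xi> \<in> rays T"
      by (rule automorphism_ray[OF subgroup_Aut_automorphism[OF sub r2(1)] eng.prems])
    \<comment> \<open>The moved ray still passes through \<open>\<xi> n\<close>, so both factors lie
      in the rigid stabilizer of the same vertex.\<close>
    have "(r2 \<circ> \<xi>) n = \<xi> n"
      using Rist_fixes_vertex[OF S r2(1) ray_level[OF eng.prems]] by simp
    then obtain r1 where r1: "r1 \<in> Rist T S (\<xi> n)" "h1 \<circ> (r2 \<circ> \<xi>) = r1 \<circ> (r2 \<circ> \<xi>)"
      using eng.IH(1)[OF r2\<xi>] by metis
    have sub_lev: "subgroup (generate (Aut T) (\<Union>v\<in>level T n. Rist T S v)) (Aut T)"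
      using subgroup_Rist_level[OF S] by (simp add: Rist_level_def)
    have "h1 \<otimes>\<^bsub>Aut T\<^esub> h2 = h1 \<circ> h2"
      by (rule mult_Aut) (use subgroup_Aut_automorphism[OF sub_lev] eng.hyps in auto)
    then have "(h1 \<otimes>\<^bsub>Aut T\<^esub> h2) \<circ> \<xi> = (r1 \<circ> r2) \<circ> \<xi>"
      using r1(2) r2(2) by (simp add: comp_assoc)
    then show ?case using subgroup_Aut_comp[OF sub r1(1) r2(1)] by blast
  qed
  then show ?thesis using k \<xi> unfolding Rist_level_def by blast
qed

end

section \<open>Consequences of finite index and level transitivity\<close>

locale branch_action = branching_tree T for T :: "'v rooted_tree" +
  fixes G :: "('v \<Rightarrow> 'v) set"
  assumes branch: "branch_group T G"
begin

lemma subgroup_G: "subgroup G (Aut T)"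
  using branch by (simp add: branch_group_def)

lemma transitive_on_level:
  assumes "u \<in> level T n" "w \<in> level T n"
  obtains g where "g \<in> G" "g u = w"
  using branch assms unfolding branch_group_def by blast

lemma Rist_level_finite_index:
  obtains R where "finite R" "R \<subseteq> G" "\<And>g. g \<in> G \<Longrightarrow> \<exists>r\<in>R. \<exists>k\<in>Rist_level T G n. g = k \<circ> r"
proof -
  define K where "K = Rist_level T G n"
  define c where "c a = K #>\<^bsub>(Aut T)\<lparr>carrier := G\<rparr>\<^esub> a" for a
  note K = subgroup_Rist_level[OF subgroup_G, of n, folded K_def]
  have "finite (c ` G)"
  proof -
    have "c ` G = rcosets\<^bsub>(Aut T)\<lparr>carrier := G\<rparr>\<^esub> K"
      by (auto simp: RCOSETS_def c_def)
    then show ?thesis using branch by (simp add: branch_group_def K_def)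
  qed
  then obtain R where R: "R \<subseteq> G" "finite R" "c ` G = c ` R"
    using finite_subset_image[of "c ` G" c G] by auto
  have c: "c a = {k \<circ> a | k. k \<in> K}" if "a \<in> G" for a
    using mult_Aut[of _ T a] subgroup_Aut_automorphism[OF K] subgroup_Aut_automorphism[OF subgroup_G that]
    by (auto simp: c_def r_coset_def)
  have "\<exists>r\<in>R. \<exists>k\<in>K. g = k \<circ> r" if g: "g \<in> G" for g
  proof -
    obtain r where r: "r \<in> R" "c g = c r" using R(3) g by blast
    have "id \<circ> g \<in> c g" using c[OF g] subgroup_Aut_id[OF K] by blast
    then have "g \<in> c r" using r(2) by simp
    moreover have "r \<in> G" using r R by blast
    ultimately show ?thesis using c r by blast
  qed
  then show thesis using that[OF R(2) R(1)] by (simp add: K_def)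
qed

text \<open>Transitivity makes the level a single orbit, while the rigid level stabilizer fixes the
  level pointwise. Writing \<open>g = k \<circ> r\<close>, the value \<open>g u\<close> depends on
  the coset representative \<open>r\<close> only.\<close>

lemma finite_level: "finite (level T n)"
proof (cases "level T n = {}")
  case False
  then obtain u where u: "u \<in> level T n" by blast
  obtain \<xi> where \<xi>: "\<xi> \<in> rays T" "\<xi> n = u" using obtain_ray_through[OF u] .
  obtain R where R: "finite R" "R \<subseteq> G"
    "\<And>g. g \<in> G \<Longrightarrow> \<exists>r\<in>R. \<exists>k\<in>Rist_level T G n. g = k \<circ> r"
    using Rist_level_finite_index[of n] by blast
  have "level T n \<subseteq> (\<lambda>r. r u) ` R"
  proof
    fix w assume "w \<in> level T n"
    then obtain g where g: "g \<in> G" "g u = w" using transitive_on_level[OF u] by blast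
    then obtain r k where rk: "r \<in> R" "k \<in> Rist_level T G n" "g = k \<circ> r" using R(3) by blast
    have r\<xi>: "r \<circ> \<xi> \<in> rays T"
      using automorphism_ray[OF subgroup_Aut_automorphism[OF subgroup_G] \<xi>(1)] rk(1) R(2) by blast
    obtain s where s: "s \<in> Rist T G ((r \<circ> \<xi>) n)" "k \<circ> (r \<circ> \<xi>) = s \<circ> (r \<circ> \<xi>)"
      using Rist_level_on_ray[OF subgroup_G rk(2) r\<xi>] by blast
    have "k (r u) = s (r u)" using fun_cong[OF s(2), of n] \<xi>(2) by simp
    also have "\<dots> = r u"
      using Rist_fixes_vertex[OF subgroup_G s(1) ray_level[OF r\<xi>]] \<xi>(2) by simp
    finally have "w = r u" using g rk(3) by simp
    then show "w \<in> (\<lambda>r. r u) ` R" using rk(1) by blast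
  qed
  then show ?thesis using R(1) finite_surj by blast
qed simp

lemma countable_vertices: "countable (UNIV :: 'v set)"
proof -
  have "(UNIV :: 'v set) = (\<Union>n. level T n)" using in_some_level by blast
  moreover have "countable (\<Union>n. level T n)" by (simp add: countable_finite finite_level)
  ultimately show ?thesis by metis
qed

text \<open>Finite index covers the \<open>G\<close>-orbit of \<open>\<xi>\<close> by finitely many
  translates of this orbit. Were it nowhere dense, so would be the \<open>G\<close>-orbit, which is
  dense by level transitivity.\<close>

lemma Rist_orbit_not_nowhere_dense:
  assumes \<xi>: "\<xi> \<in> rays T"
  shows "\<not> nowhere_dense_rays (ray_orbit (Rist T G (\<xi> n)) \<xi>)"
proof
  assume nd: "nowhere_dense_rays (ray_orbit (Rist T G (\<xi> n)) \<xi>)"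
  note sub = subgroup_Rist[OF subgroup_G]
  obtain R where R: "finite R" "R \<subseteq> G"
    "\<And>g. g \<in> G \<Longrightarrow> \<exists>r\<in>R. \<exists>k\<in>Rist_level T G n. g = k \<circ> r"
    using Rist_level_finite_index[of n] by blast
  define A where "A r = (\<lambda>\<eta>. inv_into UNIV r \<circ> \<eta>) ` ray_orbit (Rist T G (\<xi> n)) \<xi>"
    for r :: "'v \<Rightarrow> 'v"
  have inv_aut: "inv_into UNIV r \<in> tree_automorphisms T" if "r \<in> R" for r
    using that R(2) subgroup_Aut_automorphism[OF subgroup_G] subgroup_Aut_inv[OF subgroup_G] by blast
  have "nowhere_dense_rays (\<Union>r\<in>R. A r)"
  proof (rule nowhere_dense_rays_UN[OF R(1)])
    fix r assume r: "r \<in> R"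
    show "nowhere_dense_rays (A r)"
      unfolding A_def by (rule nowhere_dense_rays_image[OF inv_aut[OF r] nd])
    show "A r \<subseteq> rays T"
      unfolding A_def using ray_orbit_subset[OF sub \<xi>] automorphism_ray[OF inv_aut[OF r]] by blast
  qed
  moreover have "ray_orbit G \<xi> \<subseteq> (\<Union>r\<in>R. A r)"
  proof
    fix \<eta> assume "\<eta> \<in> ray_orbit G \<xi>"
    then obtain g where g: "g \<in> G" "\<eta> = g \<circ> \<xi>" by (auto simp: ray_orbit_def)
    \<comment> \<open>Cosets give decompositions \<open>k \<circ> r\<close>; applied to the inverse
      of \<open>g\<close> they let the element of the rigid level stabilizer act on
      \<open>\<xi>\<close> first.\<close>
    obtain r k where rk: "r \<in> R" "k \<in> Rist_level T G n" "inv_into UNIV g = k \<circ> r"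
      using R(3)[OF subgroup_Aut_inv[OF subgroup_G g(1)]] by blast
    have k': "inv_into UNIV k \<in> Rist_level T G n"
      using subgroup_Aut_inv[OF subgroup_Rist_level[OF subgroup_G] rk(2)] .
    obtain s where s: "s \<in> Rist T G (\<xi> n)" "inv_into UNIV k \<circ> \<xi> = s \<circ> \<xi>"
      using Rist_level_on_ray[OF subgroup_G k' \<xi>] by blast
    have kA: "k \<in> tree_automorphisms T" and rA: "r \<in> tree_automorphisms T"
      and gA: "g \<in> tree_automorphisms T"
      using subgroup_Aut_automorphism[OF subgroup_Rist_level[OF subgroup_G] rk(2)]
        subgroup_Aut_automorphism[OF subgroup_G] rk(1) R(2) g(1) by auto
    have "g x = inv_into UNIV r (inv_into UNIV k x)" for x
    proof -
      have "x = k (r (g x))"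
        using inv_tree_automorphism(1)[OF gA, of x] rk(3) by simp
      then show ?thesis
        using inv_tree_automorphism(1)[OF kA] inv_tree_automorphism(1)[OF rA] by metis
    qed
    then have "\<eta> = inv_into UNIV r \<circ> (inv_into UNIV k \<circ> \<xi>)" using g(2) by (simp add: fun_eq_iff)
    then have "\<eta> = inv_into UNIV r \<circ> (s \<circ> \<xi>)" using s(2) by simp
    then show "\<eta> \<in> (\<Union>r\<in>R. A r)" using rk(1) s(1) by (auto simp: A_def ray_orbit_def)
  qed
  ultimately have "nowhere_dense_rays (ray_orbit G \<xi>)" by (rule nowhere_dense_rays_mono)
  \<comment> \<open>Level \<open>0\<close> imposes no condition: some cone of the boundary is missed
    by the whole orbit.\<close>
  then obtain \<eta> m where \<eta>: "\<eta> \<in> rays T" "\<And>\<zeta>. \<zeta> \<in> ray_orbit G \<xi> \<Longrightarrow> \<zeta> m \<noteq> \<eta> m"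
    using nowhere_dense_raysD[OF _ \<xi>, of _ 0] by blast
  obtain g where "g \<in> G" "g (\<xi> m) = \<eta> m"
    using transitive_on_level[OF ray_level[OF \<xi>] ray_level[OF \<eta>(1)]] by blast
  then show False using \<eta>(2)[of "g \<circ> \<xi>"] by (auto simp: ray_orbit_def)
qed

section \<open>Generalized parabolic subgroups\<close>

text \<open>The one-sided form, with \<open>C\<close> merely closed, serves twice: in both
  directions for two orbit closures, and with a singleton \<open>C\<close> to exclude parabolic
  subgroups.\<close>

lemma SStab_subset_imp_subset:
  assumes C: "closedin (boundary T) C" and C': "C' \<subseteq> rays T" "nowhere_dense_rays C'"
    and sub: "SStab G C \<subseteq> SStab G C'"
  shows "C' \<subseteq> C"
proof
  fix \<xi> assume \<xi>: "\<xi> \<in> C'"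
  then have r: "\<xi> \<in> rays T" using C' by blast
  show "\<xi> \<in> C"
  proof (rule ccontr)
    assume "\<xi> \<notin> C"
    then obtain n where n: "\<And>\<eta>. \<eta> \<in> C \<Longrightarrow> \<eta> n \<noteq> \<xi> n"
      using C r unfolding closedin_boundary_iff by blast
    have "Rist T G (\<xi> n) \<subseteq> SStab G C"
    proof
      fix g assume g: "g \<in> Rist T G (\<xi> n)"
      have "g \<circ> \<eta> = \<eta>" if "\<eta> \<in> C" for \<eta>
        using Rist_fixes_ray[OF g ray_level[OF r]] n[OF that] C that
        unfolding closedin_boundary_iff by blast
      moreover have "g \<in> G" using g by (simp add: Rist_def)
      ultimately show "g \<in> SStab G C" by (simp add: SStab_def)
    qed
    then have "ray_orbit (Rist T G (\<xi> n)) \<xi> \<subseteq> C'"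
      using sub \<xi> unfolding ray_orbit_def SStab_def by blast
    then show False
      using nowhere_dense_rays_mono[OF C'(2)] Rist_orbit_not_nowhere_dense[OF r] by blast
  qed
qed

lemma parabolic_eq_SStab: "{g \<in> G. g \<circ> \<xi> = \<xi>} = SStab G {\<xi>}"
  by (auto simp: SStab_def)

lemma closedin_singleton_ray: "\<xi> \<in> rays T \<Longrightarrow> closedin (boundary T) {\<xi>}"
  by (auto simp: closedin_boundary_iff fun_eq_iff)

lemma subset_SStab_orbit_closure:
  assumes F: "subgroup F (Aut T)" "F \<subseteq> G" and \<xi>: "\<xi> \<in> rays T"
  shows "F \<subseteq> SStab G (orbit_closure F \<xi>)"
proof
  fix f assume f: "f \<in> F"
  note fA = subgroup_Aut_automorphism[OF F(1) f]
  have "\<eta> \<in> (\<lambda>\<eta>. f \<circ> \<eta>) ` orbit_closure F \<xi>" if "\<eta> \<in> orbit_closure F \<xi>" for \<eta>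
  proof
    show "inv_into UNIV f \<circ> \<eta> \<in> orbit_closure F \<xi>"
      by (rule comp_mem_orbit_closure[OF F(1) \<xi> subgroup_Aut_inv[OF F(1) f] that])
    show "\<eta> = f \<circ> (inv_into UNIV f \<circ> \<eta>)" by (simp add: fun_eq_iff inv_tree_automorphism(2)[OF fA])
  qed
  then show "f \<in> SStab G (orbit_closure F \<xi>)"
    using comp_mem_orbit_closure[OF F(1) \<xi> f] F(2) f unfolding SStab_def by blast
qed

text \<open>Minimality is inherited from \<open>F\<close>: each orbit of the setwise stabilizer on
  the closure contains an \<open>F\<close>-orbit, which is already dense there.\<close>

lemma generalized_parabolic_orbit_closure:
  assumes F: "subgroup F (Aut T)" "F \<subseteq> G" and \<xi>: "\<xi> \<in> rays T"
    and nd: "nowhere_dense_rays (orbit_closure F \<xi>)"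
  shows "generalized_parabolic T G (SStab G (orbit_closure F \<xi>))"
proof -
  let ?C = "orbit_closure F \<xi>"
  have "minimal_action T (SStab G ?C) ?C"
    unfolding minimal_action_def
  proof
    fix \<eta> assume \<eta>: "\<eta> \<in> ?C"
    have "?C \<subseteq> orbit_closure (SStab G ?C) \<eta>"
      using closure_of_mono[OF ray_orbit_mono[OF subset_SStab_orbit_closure[OF F \<xi>]]]
        orbit_closure_eq[OF F(1) \<xi> \<eta>] by blast
    moreover have "ray_orbit (SStab G ?C) \<eta> \<subseteq> ?C"
      using SStab_comp_mem[OF \<eta>] by (auto simp: ray_orbit_def)
    ultimately show "Abstract_Topology.closure_of (subtopology (boundary T) ?C)
        (ray_orbit (SStab G ?C) \<eta>) = ?C"
      by (auto simp: closure_of_subtopology Int_absorb1)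
  qed
  moreover have "\<not> openin (boundary T) ?C"
    by (rule nowhere_dense_rays_not_open[OF nd mem_orbit_closure[OF F(1) \<xi>]])
  ultimately show ?thesis
    unfolding generalized_parabolic_def using closedin_closure_of by blast
qed

lemma inj_on_SStab_orbit_closures:
  assumes nd: "\<And>\<xi>. \<xi> \<in> rays T \<Longrightarrow> nowhere_dense_rays (orbit_closure F \<xi>)"
  shows "inj_on (SStab G) (orbit_closure F ` rays T)"
proof (rule inj_onI)
  fix C D
  assume C: "C \<in> orbit_closure F ` rays T" and D: "D \<in> orbit_closure F ` rays T"
    and eq: "SStab G C = SStab G D"
  have *: "closedin (boundary T) E" "E \<subseteq> rays T" "nowhere_dense_rays E"
    if "E \<in> orbit_closure F ` rays T" for E
    using that nd orbit_closure_subset_rays closedin_closure_of by blast+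
  show "C = D"
    using SStab_subset_imp_subset[OF *(1)[OF C] *(2,3)[OF D]]
      SStab_subset_imp_subset[OF *(1)[OF D] *(2,3)[OF C]] eq by blast
qed

lemma not_parabolic_SStab_orbit_closure:
  assumes nd: "nowhere_dense_rays (orbit_closure F \<xi>)"
    and "\<alpha> \<in> orbit_closure F \<xi>" "\<beta> \<in> orbit_closure F \<xi>" "\<alpha> \<noteq> \<beta>"
  shows "\<not> parabolic T G (SStab G (orbit_closure F \<xi>))"
proof
  assume "parabolic T G (SStab G (orbit_closure F \<xi>))"
  then obtain \<eta> where \<eta>: "\<eta> \<in> rays T" "SStab G (orbit_closure F \<xi>) = SStab G {\<eta>}"
    unfolding parabolic_def parabolic_eq_SStab by blast
  have "orbit_closure F \<xi> \<subseteq> {\<eta>}"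
    by (rule SStab_subset_imp_subset[OF closedin_singleton_ray[OF \<eta>(1)] orbit_closure_subset_rays nd])
      (simp add: \<eta>(2))
  then show False using assms by blast
qed

lemma finite_vertex_orbit:
  assumes "subgroup F (Aut T)"
  shows "finite ((\<lambda>f. f v) ` F)"
proof -
  obtain n where n: "v \<in> level T n" using in_some_level by blast
  have "(\<lambda>f. f v) ` F \<subseteq> level T n"
    using automorphism_level[OF subgroup_Aut_automorphism[OF assms] n] by blast
  then show ?thesis using finite_level finite_subset by blast
qed

lemma nowhere_dense_orbit_closure_Stab:
  assumes F: "subgroup F (Aut T)" and \<xi>: "\<xi> \<in> rays T"
    and not_open: "\<not> openin (boundary T) (orbit_closure (Stab F v) \<xi>)"
  shows "nowhere_dense_rays (orbit_closure F \<xi>)"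
proof (rule nowhere_dense_rays_closure)
  note S = subgroup_Stab[OF F, of v]
  obtain R where R: "finite R" "R \<subseteq> F" "F = (\<Union>f\<in>R. (\<lambda>s. f \<circ> s) ` Stab F v)"
    using Stab_cosets_orbit[OF F finite_vertex_orbit[OF F]] by blast
  have RA: "f \<in> tree_automorphisms T" if "f \<in> R" for f
    using that R(2) subgroup_Aut_automorphism[OF F] by blast
  show "nowhere_dense_rays (ray_orbit F \<xi>)"
    unfolding ray_orbit_cosets[OF R(3)]
  proof (rule nowhere_dense_rays_UN[OF R(1)])
    fix f assume f: "f \<in> R"
    show "nowhere_dense_rays ((\<lambda>\<eta>. f \<circ> \<eta>) ` ray_orbit (Stab F v) \<xi>)"
      by (rule nowhere_dense_rays_image[OF RA[OF f] nowhere_dense_orbit[OF S \<xi> not_open]])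
    show "(\<lambda>\<eta>. f \<circ> \<eta>) ` ray_orbit (Stab F v) \<xi> \<subseteq> rays T"
      using ray_orbit_subset[OF S \<xi>] automorphism_ray[OF RA[OF f]] by blast
  qed
qed

text \<open>The \<open>F\<close>-orbit is a finite union of closed countable translates, so it is
  countable and equal to its closure.\<close>

lemma countable_orbit_closure_Stab:
  assumes F: "subgroup F (Aut T)" and \<xi>: "\<xi> \<in> rays T"
    and count: "countable (ray_orbit (Stab F v) \<xi>)"
    and closed: "closedin (boundary T) (ray_orbit (Stab F v) \<xi>)"
  shows "countable (orbit_closure F \<xi>)"
proof -
  obtain R where R: "finite R" "R \<subseteq> F" "F = (\<Union>f\<in>R. (\<lambda>s. f \<circ> s) ` Stab F v)"
    using Stab_cosets_orbit[OF F finite_vertex_orbit[OF F]] by blast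
  have RA: "f \<in> tree_automorphisms T" if "f \<in> R" for f
    using that R(2) subgroup_Aut_automorphism[OF F] by blast
  have "closedin (boundary T) (ray_orbit F \<xi>)"
    unfolding ray_orbit_cosets[OF R(3)]
    by (rule closedin_Union) (use R(1) RA closedin_boundary_image closed in auto)
  then have "orbit_closure F \<xi> = ray_orbit F \<xi>"
    by (rule closure_of_closedin)
  also have "countable \<dots>"
    unfolding ray_orbit_cosets[OF R(3)] using R(1) count by (auto intro: countable_finite)
  finally show ?thesis .
qed

lemma countable_imp_not_open:
  assumes "countable A" "\<xi> \<in> A"
  shows "\<not> openin (boundary T) A"
proof
  assume "openin (boundary T) A"
  then obtain n where \<xi>: "\<xi> \<in> rays T" and n: "{\<eta> \<in> rays T. \<eta> n = \<xi> n} \<subseteq> A"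
    using assms(2) unfolding openin_boundary_iff by blast
  show False
    using uncountable_rays_through[OF ray_level[OF \<xi>]] countable_subset[OF n assms(1)] by blast
qed

text \<open>A closed set of rays is determined by the set of vertices it meets, and there are only
  countably many vertices.\<close>

lemma generalized_parabolic_lepoll: "{H. generalized_parabolic T G H} \<lesssim> (UNIV :: nat set set)"
proof -
  define sst where "sst V = SStab G {\<xi> \<in> rays T. \<forall>n. \<xi> n \<in> V}" for V :: "'v set"
  have "{H. generalized_parabolic T G H} \<subseteq> range sst"
  proof
    fix H assume "H \<in> {H. generalized_parabolic T G H}"
    then obtain C where C: "closedin (boundary T) C" "H = SStab G C"
      by (auto simp: generalized_parabolic_def)
    define V where "V = {\<xi> n | \<xi> n. \<xi> \<in> C}"
    have CV: "C \<subseteq> {\<xi> \<in> rays T. \<forall>n. \<xi> n \<in> V}"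
      using C(1) by (auto simp: closedin_boundary_iff V_def)
    have "\<xi> \<in> C" if \<xi>: "\<xi> \<in> rays T" "\<And>n. \<xi> n \<in> V" for \<xi>
    proof -
      have "\<exists>\<eta>\<in>C. \<eta> n = \<xi> n" for n
      proof -
        obtain \<eta> m where \<eta>: "\<eta> \<in> C" "\<xi> n = \<eta> m" using \<xi>(2)[of n] by (auto simp: V_def)
        then have "\<eta> \<in> rays T" using C(1) by (auto simp: closedin_boundary_iff)
        \<comment> \<open>The level of the common vertex forces it to occur at the same index on
          both rays.\<close>
        then have "m = n" using level_unique ray_level \<xi>(1) \<eta>(2) by metis
        then show ?thesis using \<eta> by metis
      qed
      then show ?thesis using C(1) \<xi>(1) by (simp add: closedin_boundary_iff)
    qed
    then have "C = {\<xi> \<in> rays T. \<forall>n. \<xi> n \<in> V}" using CV by blast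
    then show "H \<in> range sst" using C(2) by (auto simp: sst_def)
  qed
  then have "{H. generalized_parabolic T G H} \<lesssim> (UNIV :: 'v set set)"
    by (rule subset_image_lepoll)
  also have "(UNIV :: 'v set set) \<lesssim> (UNIV :: nat set set)"
  proof -
    have "inj ((`) (to_nat_on (UNIV :: 'v set)) :: 'v set \<Rightarrow> nat set)"
      using inj_on_to_nat_on[OF countable_vertices] by (simp add: inj_image_eq_iff inj_on_def)
    then show ?thesis unfolding lepoll_def by blast
  qed
  finally show ?thesis .
qed

end

section \<open>Counting distinct orbit closures, and the theorem\<close>

text \<open>A point is recovered from its class \<open>c x\<close> and its number in an enumeration
  of that class, so \<open>D\<close> embeds into the classes times the naturals; the countable
  factor is absorbed by the infinite set of classes.\<close>

lemma continuum_lepoll_image_countable_fibres: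
  fixes c :: "'a \<Rightarrow> 'a set"
  assumes D: "(UNIV :: nat set set) \<lesssim> D"
    and mem: "\<And>x. x \<in> D \<Longrightarrow> x \<in> c x" and count: "\<And>x. x \<in> D \<Longrightarrow> countable (c x)"
  shows "(UNIV :: nat set set) \<lesssim> c ` D"
proof -
  have "D \<lesssim> c ` D \<times> (UNIV :: nat set)"
    unfolding lepoll_def
  proof (intro exI conjI)
    show "inj_on (\<lambda>x. (c x, to_nat_on (c x) x)) D"
    proof (rule inj_onI)
      fix x y
      assume xy: "x \<in> D" "y \<in> D" and "(c x, to_nat_on (c x) x) = (c y, to_nat_on (c y) y)"
      then have c: "c y = c x" and "to_nat_on (c x) x = to_nat_on (c x) y" by auto
      moreover have "x \<in> c x" "y \<in> c x" using mem xy c by auto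
      ultimately show "x = y" using to_nat_on_inj[OF count[OF xy(1)]] by blast
    qed
  qed auto
  then have DO: "(UNIV :: nat set set) \<lesssim> c ` D \<times> (UNIV :: nat set)"
    using lepoll_trans[OF D] by blast
  have inf: "infinite (c ` D)"
  proof
    assume "finite (c ` D)"
    then have "countable (c ` D \<times> (UNIV :: nat set))"
      by (rule countable_SIGMA[OF countable_finite]) (rule countableI_type)
    then show False using countable_lepoll[OF _ DO] uncountable_UNIV_nat_set by blast
  qed
  then have "ordLeq3 (card_of (UNIV :: nat set)) (card_of (c ` D))"
    by (simp add: infinite_iff_card_of_nat)
  then have "c ` D \<times> (UNIV :: nat set) \<approx> c ` D"
    using inf by (simp add: eqpoll_iff_card_of_ordIso card_of_Times_infinite_simps)
  then show ?thesis using DO lepoll_trans2 by blast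
qed

theorem corollary1p7:
  fixes T :: "'v rooted_tree" and G F :: "('v \<Rightarrow> 'v) set" and v :: 'v
  assumes "rooted_tree T" and "spherically_regular T" and "branching T"
    and "branch_group T G"
    and "subgroup F ((Aut T)\<lparr>carrier := G\<rparr>)"
  shows "((\<forall>\<xi>\<in>rays T.
             \<not> openin (boundary T) (boundary T closure_of ray_orbit (Stab F v) \<xi>)) \<longrightarrow>
           uncountable {H. generalized_parabolic T G H \<and> F \<subseteq> H})
       \<and> ((\<forall>\<xi>\<in>rays T. countable (ray_orbit (Stab F v) \<xi>) \<and>
             closedin (boundary T) (ray_orbit (Stab F v) \<xi>)) \<longrightarrow>
           continuum {H. generalized_parabolic T G H \<and> F \<subseteq> H} \<and>
           (Stab F v \<noteq> {id} \<longrightarrow>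
             continuum {H. generalized_parabolic T G H \<and> \<not> parabolic T G H \<and> F \<subseteq> H}))"
proof -
  interpret branch_action T G
    by unfold_locales (use assms in auto)
  have F: "subgroup F (Aut T)"
    by (rule group.incl_subgroup[OF group_Aut subgroup_G assms(5)])
  have FG: "F \<subseteq> G" using subgroup.subset[OF assms(5)] by simp
  have good: "generalized_parabolic T G (SStab G (orbit_closure F \<xi>))"
    "F \<subseteq> SStab G (orbit_closure F \<xi>)"
    if "\<xi> \<in> rays T" "nowhere_dense_rays (orbit_closure F \<xi>)" for \<xi>
    using generalized_parabolic_orbit_closure[OF F FG that]
      subset_SStab_orbit_closure[OF F FG that(1)] by auto
  show ?thesis
  proof (intro conjI impI)
    assume not_open: "\<forall>\<xi>\<in>rays T.
      \<not> openin (boundary T) (boundary T closure_of ray_orbit (Stab F v) \<xi>)"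
    then have nd: "nowhere_dense_rays (orbit_closure F \<xi>)" if "\<xi> \<in> rays T" for \<xi>
      using nowhere_dense_orbit_closure_Stab[OF F that] that by blast
    show "uncountable {H. generalized_parabolic T G H \<and> F \<subseteq> H}"
    proof
      assume "countable {H. generalized_parabolic T G H \<and> F \<subseteq> H}"
      then have "countable (SStab G ` orbit_closure F ` rays T)"
        unfolding image_image
        by (rule countable_subset[rotated])
          (use good nd in \<open>intro image_subsetI CollectI conjI, auto\<close>)
      then have "countable (orbit_closure F ` rays T)"
        by (rule countable_image_inj_on) (rule inj_on_SStab_orbit_closures[OF nd])
      moreover have "rays T \<noteq> {}"
        using obtain_ray_through[of "tree_root T" 0] by (auto simp: level_0)
      \<comment> \<open>Countably many stabilizers mean countably many orbit closures; these cover
        the boundary, against the Baire property.\<close>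
      ultimately obtain A :: "nat \<Rightarrow> _" where A: "orbit_closure F ` rays T = range A"
        using range_from_nat_into[of "orbit_closure F ` rays T"] by (metis image_is_empty)
      have "\<exists>\<xi>\<in>rays T. A i = orbit_closure F \<xi>" for i
        using rangeI[of A i] unfolding A[symmetric] by (rule imageE) blast
      then have "nowhere_dense_rays (A i) \<and> A i \<subseteq> rays T" for i
        using nd orbit_closure_subset_rays by metis
      then have "\<not> rays T \<subseteq> (\<Union>i. A i)" by (intro rays_Baire) auto
      moreover have "rays T \<subseteq> (\<Union>i. A i)"
        using mem_orbit_closure[OF F] unfolding A[symmetric] by blast
      ultimately show False by contradiction
    qed
  next
    assume hyp: "\<forall>\<xi>\<in>rays T. countable (ray_orbit (Stab F v) \<xi>) \<and>
             closedin (boundary T) (ray_orbit (Stab F v) \<xi>)"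
    have nd: "nowhere_dense_rays (orbit_closure F \<xi>)" if \<xi>: "\<xi> \<in> rays T" for \<xi>
    proof (rule nowhere_dense_orbit_closure_Stab[OF F \<xi>])
      \<comment> \<open>A closed orbit is its own closure; being countable and non-empty it is not
        open, because cones are uncountable.\<close>
      have "orbit_closure (Stab F v) \<xi> = ray_orbit (Stab F v) \<xi>"
        using hyp \<xi> closure_of_closedin by blast
      then show "\<not> openin (boundary T) (orbit_closure (Stab F v) \<xi>)"
        using countable_imp_not_open mem_orbit_closure[OF subgroup_Stab[OF F] \<xi>] hyp \<xi> by metis
    qed
    have count: "countable (orbit_closure F \<xi>)" if "\<xi> \<in> rays T" for \<xi>
      using countable_orbit_closure_Stab[OF F that] hyp that by blast
    \<comment> \<open>The lower bound holds inside every cone: the cone of the root gives the first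
      count, the cone of a moved vertex the non-parabolic one.\<close>
    have many: "(UNIV :: nat set set) \<lesssim> SStab G ` orbit_closure F ` {\<xi> \<in> rays T. \<xi> n = u}"
      if u: "u \<in> level T n" for u n
    proof -
      let ?D = "{\<xi> \<in> rays T. \<xi> n = u}"
      have "(UNIV :: nat set set) \<lesssim> orbit_closure F ` ?D"
        by (rule continuum_lepoll_image_countable_fibres[OF nat_set_lepoll_rays_through[OF u]])
          (use mem_orbit_closure[OF F] count in auto)
      also have "orbit_closure F ` ?D \<approx> SStab G ` orbit_closure F ` ?D"
        by (rule eqpoll_sym, rule inj_on_image_eqpoll_self,
            rule inj_on_subset[OF inj_on_SStab_orbit_closures[OF nd]]) auto
      finally show ?thesis .
    qed
    \<comment> \<open>Schroeder-Bernstein with the upper bound on all generalized parabolic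
      subgroups.\<close>
    have between: "continuum X"
      if "u \<in> level T n" "SStab G ` orbit_closure F ` {\<xi> \<in> rays T. \<xi> n = u} \<subseteq> X"
        "X \<subseteq> {H. generalized_parabolic T G H}" for X u n
      unfolding continuum_def
      using lepoll_antisym lepoll_trans[OF subset_imp_lepoll[OF that(3)] generalized_parabolic_lepoll]
        lepoll_trans[OF many[OF that(1)] subset_imp_lepoll[OF that(2)]] by blast
    show "continuum {H. generalized_parabolic T G H \<and> F \<subseteq> H}"
    proof (rule between)
      show "tree_root T \<in> level T 0" by (simp add: level_0)
      show "SStab G ` orbit_closure F ` {\<xi> \<in> rays T. \<xi> 0 = tree_root T}
          \<subseteq> {H. generalized_parabolic T G H \<and> F \<subseteq> H}"
        unfolding image_image
      proof (rule image_subsetI)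
        fix \<xi> assume "\<xi> \<in> {\<xi> \<in> rays T. \<xi> 0 = tree_root T}"
        then have \<xi>: "\<xi> \<in> rays T" by blast
        show "SStab G (orbit_closure F \<xi>) \<in> {H. generalized_parabolic T G H \<and> F \<subseteq> H}"
          using good[OF \<xi> nd[OF \<xi>]] by (intro CollectI conjI)
      qed
    qed (rule Collect_mono, simp)
    show "continuum {H. generalized_parabolic T G H \<and> \<not> parabolic T G H \<and> F \<subseteq> H}"
      if nontrivial: "Stab F v \<noteq> {id}"
    proof -
      have "id \<in> Stab F v" using subgroup_Aut_id[OF subgroup_Stab[OF F]] .
      then obtain f where f: "f \<in> Stab F v" "f \<noteq> id" using nontrivial by blast
      then obtain u where u: "f u \<noteq> u" by (auto simp: fun_eq_iff)
      obtain n where n: "u \<in> level T n" using in_some_level by blast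
      have fF: "f \<in> F" using f by (simp add: Stab_def)
      \<comment> \<open>Each ray through the moved vertex \<open>u\<close> is moved by
        \<open>f\<close>, so its orbit closure has at least two points.\<close>
      have np: "\<not> parabolic T G (SStab G (orbit_closure F \<xi>))" if \<xi>: "\<xi> \<in> rays T" "\<xi> n = u" for \<xi>
      proof (rule not_parabolic_SStab_orbit_closure[OF nd[OF \<xi>(1)]])
        show "\<xi> \<in> orbit_closure F \<xi>" by (rule mem_orbit_closure[OF F \<xi>(1)])
        then show "f \<circ> \<xi> \<in> orbit_closure F \<xi>" by (rule comp_mem_orbit_closure[OF F \<xi>(1) fF])
        have "(f \<circ> \<xi>) n \<noteq> \<xi> n" using u \<xi>(2) by simp
        then show "\<xi> \<noteq> f \<circ> \<xi>" by metis
      qed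
      show ?thesis
      proof (rule between[OF n])
        show "SStab G ` orbit_closure F ` {\<xi> \<in> rays T. \<xi> n = u}
            \<subseteq> {H. generalized_parabolic T G H \<and> \<not> parabolic T G H \<and> F \<subseteq> H}"
          unfolding image_image
        proof (rule image_subsetI)
          fix \<xi> assume "\<xi> \<in> {\<xi> \<in> rays T. \<xi> n = u}"
          then have \<xi>: "\<xi> \<in> rays T" "\<xi> n = u" by auto
          show "SStab G (orbit_closure F \<xi>)
              \<in> {H. generalized_parabolic T G H \<and> \<not> parabolic T G H \<and> F \<subseteq> H}"
            using good[OF \<xi>(1) nd[OF \<xi>(1)]] np[OF \<xi>] by (intro CollectI conjI)
        qed
      qed (rule Collect_mono, simp)
    qed
  qed
qed

end
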